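(* Let $\Omega$ be a Polish space and $(T_n)_{n\in\mathbb{N}}\subset\mathscr{L}(\mathscr{M}(\Omega),\sigma)$ a sequence of weakly continuous operators that is order bounded in $\mathscr{L}(\mathscr{M}(\Omega))$ (there are $R,S\in\mathscr{L}(\mathscr{M}(\Omega))$ with $R\le T_n\le S$ for all $n$). Then $\sup_n T_n$ exists in $\mathscr{L}(\mathscr{M}(\Omega))$ and is weakly continuous. In particular $\mathscr{L}(\mathscr{M}(\Omega),\sigma)$ is $\sigma$-order complete.
   Context: $\mathscr{M}(\Omega)$ is the Banach lattice of finite signed Borel measures; $\mathscr{L}(\mathscr{M}(\Omega))$ the bounded operators on it, ordered by $S\le T$ iff $S\mu\le T\mu$ for all positive $\mu$. A transition kernel is a map $k:\Omega\times\mathscr{B}(\Omega)\to\mathbb{R}$, finite signed measure in the second variable and Borel measurable in the first; bounded if $\sup_x\lvert k\rvert(x,\Omega)<\infty$. $T$ is weakly continuous if $(T\mu)(A)=\int k(x,A)\,d\mu(x)$ for some bounded transition kernel $k$; $\mathscr{L}(\mathscr{M}(\Omega),\sigma)$ is the space of weakly continuous operators. *)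

theory Defs
  imports "HOL-Analysis.Analysis"
begin

text \<open>Finite signed Borel measures on a topological space, represented as real-valued
  set functions that are countably additive on Borel sets and (by convention) vanish
  on non-Borel sets, so that each signed measure has a unique representative.\<close>

definition signed_measure :: "('a::topological_space set \<Rightarrow> real) \<Rightarrow> bool" where
  "signed_measure \<mu> \<longleftrightarrow>
     (\<forall>A. A \<notin> sets borel \<longrightarrow> \<mu> A = 0) \<and>
     \<mu> {} = 0 \<and>
     (\<forall>A::nat \<Rightarrow> 'a set. range A \<subseteq> sets borel \<longrightarrow> disjoint_family A \<longrightarrow>
        (\<lambda>n. \<mu> (A n)) sums \<mu> (\<Union>n. A n))"

definition Meas :: "('a::topological_space set \<Rightarrow> real) set" where
  "Meas = {\<mu>. signed_measure \<mu>}"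

definition pos_meas :: "('a::topological_space set \<Rightarrow> real) \<Rightarrow> bool" where
  "pos_meas \<mu> \<longleftrightarrow> signed_measure \<mu> \<and> (\<forall>A. 0 \<le> \<mu> A)"

definition meas_le :: "('a::topological_space set \<Rightarrow> real) \<Rightarrow> ('a set \<Rightarrow> real) \<Rightarrow> bool" where
  "meas_le \<mu> \<nu> \<longleftrightarrow> (\<forall>A. \<mu> A \<le> \<nu> A)"

definition tv_norm :: "('a::topological_space set \<Rightarrow> real) \<Rightarrow> real" where
  "tv_norm \<mu> = Sup {(\<Sum>i<n. \<bar>\<mu> (P i)\<bar>) | (n::nat) P.
       (\<forall>i<n. P i \<in> sets borel) \<and> disjoint_family_on P {..<n}}"

definition bounded_op :: "(('a::topological_space set \<Rightarrow> real) \<Rightarrow> ('a set \<Rightarrow> real)) \<Rightarrow> bool" where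
  "bounded_op T \<longleftrightarrow>
     (\<forall>\<mu>\<in>Meas. T \<mu> \<in> Meas) \<and>
     (\<forall>\<mu>\<in>Meas. \<forall>\<nu>\<in>Meas. \<forall>a b::real.
        T (\<lambda>A. a * \<mu> A + b * \<nu> A) = (\<lambda>A. a * T \<mu> A + b * T \<nu> A)) \<and>
     (\<exists>C. \<forall>\<mu>\<in>Meas. tv_norm (T \<mu>) \<le> C * tv_norm \<mu>)"

definition op_le :: "(('a::topological_space set \<Rightarrow> real) \<Rightarrow> ('a set \<Rightarrow> real)) \<Rightarrow>
    (('a set \<Rightarrow> real) \<Rightarrow> ('a set \<Rightarrow> real)) \<Rightarrow> bool" where
  "op_le S T \<longleftrightarrow> (\<forall>\<mu>. pos_meas \<mu> \<longrightarrow> meas_le (S \<mu>) (T \<mu>))"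

definition jordan_pos :: "('a::topological_space set \<Rightarrow> real) \<Rightarrow> 'a set \<Rightarrow> real" where
  "jordan_pos \<mu> A = (if A \<in> sets borel then Sup {\<mu> B | B. B \<in> sets borel \<and> B \<subseteq> A} else 0)"

definition jordan_neg :: "('a::topological_space set \<Rightarrow> real) \<Rightarrow> 'a set \<Rightarrow> real" where
  "jordan_neg \<mu> = jordan_pos (\<lambda>A. - \<mu> A)"

definition meas_of_fun :: "('a::topological_space set \<Rightarrow> real) \<Rightarrow> 'a measure" where
  "meas_of_fun \<nu> = measure_of UNIV (sets borel) (\<lambda>A. ennreal (\<nu> A))"

definition signed_integral :: "('a::topological_space \<Rightarrow> real) \<Rightarrow> ('a set \<Rightarrow> real) \<Rightarrow> real" where
  "signed_integral f \<mu> =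
     integral\<^sup>L (meas_of_fun (jordan_pos \<mu>)) f - integral\<^sup>L (meas_of_fun (jordan_neg \<mu>)) f"

definition bounded_kernel :: "('a::topological_space \<Rightarrow> 'a set \<Rightarrow> real) \<Rightarrow> bool" where
  "bounded_kernel k \<longleftrightarrow>
     (\<forall>x. signed_measure (k x)) \<and>
     (\<forall>A\<in>sets borel. (\<lambda>x. k x A) \<in> borel_measurable borel) \<and>
     (\<exists>C. \<forall>x. tv_norm (k x) \<le> C)"

definition weakly_continuous :: "(('a::topological_space set \<Rightarrow> real) \<Rightarrow> ('a set \<Rightarrow> real)) \<Rightarrow> bool" where
  "weakly_continuous T \<longleftrightarrow> bounded_op T \<and>
     (\<exists>k. bounded_kernel k \<and>
        (\<forall>\<mu>\<in>Meas. \<forall>A\<in>sets borel. T \<mu> A = signed_integral (\<lambda>x. k x A) \<mu>))"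

definition is_op_sup :: "(nat \<Rightarrow> ('a::topological_space set \<Rightarrow> real) \<Rightarrow> ('a set \<Rightarrow> real)) \<Rightarrow>
    (('a set \<Rightarrow> real) \<Rightarrow> ('a set \<Rightarrow> real)) \<Rightarrow> bool" where
  "is_op_sup T U \<longleftrightarrow> bounded_op U \<and> (\<forall>n. op_le (T n) U) \<and>
     (\<forall>V. bounded_op V \<longrightarrow> (\<forall>n. op_le (T n) V) \<longrightarrow> op_le U V)"

end

theory Submission
  imports Defs
begin

text \<open>Suprema can be taken pointwise on kernels. If \<open>T n\<close> has kernel \<open>k n\<close>, let \<open>h n x\<close> be the
  supremum of \<open>k 0 x, \<dots>, k n x\<close> in the lattice of measures. Testing the upper bound \<open>S\<close> on
  Dirac measures shows that \<open>h n x\<close> increases to a uniformly bounded kernel, whose operator is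
  the supremum.

  For finite suprema it is enough to treat the positive part of a kernel \<open>q\<close>. By outer
  regularity, \<open>jordan_pos (q x) A\<close> is the supremum of the values \<open>q x (A \<inter> W j)\<close> for one
  countable family \<open>W\<close> of finite unions of basic open sets, hence measurable in \<open>x\<close>. Let \<open>V\<close> be
  a positive operator that dominates the operator of \<open>q\<close>, and let \<open>\<mu>\<close> be positive. Cutting \<open>\<mu>\<close>
  into pieces on which the maximum of finitely many of these functions is attained at a fixed
  index shows that the integral of this maximum is at most \<open>V \<mu> A\<close>, whatever the form of \<open>V\<close>.\<close>

subsection \<open>Finite signed measures\<close>

lemma signed_measure_notin_borel: "signed_measure \<mu> \<Longrightarrow> A \<notin> sets borel \<Longrightarrow> \<mu> A = 0"
  by (simp add: signed_measure_def)

lemma signed_measure_empty: "signed_measure \<mu> \<Longrightarrow> \<mu> {} = 0"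
  by (simp add: signed_measure_def)

lemma signed_measure_sums:
  "signed_measure \<mu> \<Longrightarrow> range A \<subseteq> sets borel \<Longrightarrow> disjoint_family A \<Longrightarrow>
    (\<lambda>n. \<mu> (A n)) sums \<mu> (\<Union>n. A n)"
  by (simp add: signed_measure_def)

text \<open>Padding the pair with empty sets gives a disjoint sequence to which countable additivity
  applies.\<close>

lemma signed_measure_Un:
  assumes "signed_measure \<mu>" "A \<in> sets borel" "B \<in> sets borel" "A \<inter> B = {}"
  shows "\<mu> (A \<union> B) = \<mu> A + \<mu> B"
proof -
  have "(\<lambda>n. \<mu> (binaryset A B n)) sums \<mu> (\<Union>n. binaryset A B n)"
    using assms
    by (intro signed_measure_sums)
       (auto simp: disjoint_family_on_def binaryset_def range_binaryset_eq)
  moreover have "(\<lambda>n. \<mu> (binaryset A B n)) sums (\<mu> A + \<mu> B)"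
    using assms by (intro binaryset_sums) (simp add: signed_measure_empty)
  ultimately show ?thesis
    by (simp add: UN_binaryset_eq sums_unique2)
qed

lemma signed_measure_split:
  assumes "signed_measure \<mu>" "A \<in> sets borel" "E \<in> sets borel"
  shows "\<mu> A = \<mu> (A \<inter> E) + \<mu> (A - E)"
  using signed_measure_Un[OF assms(1), of "A \<inter> E" "A - E"] assms
  by (simp add: Int_Diff_Un Int_Diff_disjoint)

lemma signed_measure_Diff:
  assumes "signed_measure \<mu>" "A \<in> sets borel" "B \<in> sets borel" "B \<subseteq> A"
  shows "\<mu> (A - B) = \<mu> A - \<mu> B"
  using signed_measure_split[of \<mu> A B] assms by (simp add: Int_absorb1)

lemma signed_measure_finite_UN:
  assumes "signed_measure \<mu>" "finite I" "\<And>i. i \<in> I \<Longrightarrow> P i \<in> sets borel" "disjoint_family_on P I"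
  shows "\<mu> (\<Union>i\<in>I. P i) = (\<Sum>i\<in>I. \<mu> (P i))"
  using assms(2-4)
proof (induction I rule: finite_induct)
  case empty
  then show ?case using assms(1) by (simp add: signed_measure_empty)
next
  case (insert i I)
  have "P i \<inter> (\<Union>i\<in>I. P i) = {}"
    using insert.prems(2) insert.hyps by (auto simp: disjoint_family_on_def)
  moreover have "disjoint_family_on P I"
    using insert.prems(2) by (auto simp: disjoint_family_on_def)
  ultimately show ?case
    using insert by (simp add: signed_measure_Un[OF assms(1)] sets.finite_UN)
qed

lemma signed_measure_linear:
  assumes "signed_measure \<mu>" "signed_measure \<nu>"
  shows "signed_measure (\<lambda>A. a * \<mu> A + b * \<nu> A)"
  using assms unfolding signed_measure_def by (auto intro!: sums_add sums_mult)

lemma signed_measure_add: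
  "signed_measure \<mu> \<Longrightarrow> signed_measure \<nu> \<Longrightarrow> signed_measure (\<lambda>A. \<mu> A + \<nu> A)"
  using signed_measure_linear[of \<mu> \<nu> 1 1] by simp

lemma signed_measure_diff:
  "signed_measure \<mu> \<Longrightarrow> signed_measure \<nu> \<Longrightarrow> signed_measure (\<lambda>A. \<mu> A - \<nu> A)"
  using signed_measure_linear[of \<mu> \<nu> 1 "-1"] by simp

lemma signed_measure_uminus:
  "signed_measure \<mu> \<Longrightarrow> signed_measure (\<lambda>A. - \<mu> A)"
  using signed_measure_linear[of \<mu> \<mu> "-1" 0] by simp

text \<open>If the values on subsets of \<open>E\<close> are unbounded, one can split \<open>E\<close> into two
  pieces that both have large measure and keep the piece on which they are still unbounded;
  iterating this yields infinitely many disjoint sets of measure at least 1 in absolute value.\<close>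

lemma signed_measure_bounded:
  assumes \<mu>: "signed_measure \<mu>"
  obtains C where "\<And>A. \<bar>\<mu> A\<bar> \<le> C"
proof -
  define unb where "unb E \<longleftrightarrow> E \<in> sets borel \<and>
    (\<forall>C. \<exists>A\<in>sets borel. A \<subseteq> E \<and> \<bar>\<mu> A\<bar> > C)" for E
  have step: "\<exists>F. unb F \<and> F \<subseteq> E \<and> \<bar>\<mu> (E - F)\<bar> \<ge> 1" if E: "unb E" for E
  proof -
    \<comment> \<open>The threshold \<open>\<bar>\<mu> E\<bar> + 1\<close> forces both
      \<open>A\<close> and \<open>E - A\<close> to have measure at least 1 in absolute value, since
      \<open>\<mu> (E - A) = \<mu> E - \<mu> A\<close>.\<close>
    obtain A where A: "A \<in> sets borel" "A \<subseteq> E" "\<bar>\<mu> A\<bar> > \<bar>\<mu> E\<bar> + 1"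
      using E unfolding unb_def by blast
    have EB: "E \<in> sets borel" using E by (simp add: unb_def)
    have eq: "\<mu> (E - A) = \<mu> E - \<mu> A"
      using signed_measure_Diff[OF \<mu> EB A(1,2)] .
    have big: "\<bar>\<mu> A\<bar> \<ge> 1" "\<bar>\<mu> (E - A)\<bar> \<ge> 1"
      using A(3) eq by linarith+
    have "unb A \<or> unb (E - A)"
    proof (rule ccontr)
      assume "\<not> (unb A \<or> unb (E - A))"
      then obtain C D where C: "\<And>B. B \<in> sets borel \<Longrightarrow> B \<subseteq> A \<Longrightarrow> \<bar>\<mu> B\<bar> \<le> C"
        and D: "\<And>B. B \<in> sets borel \<Longrightarrow> B \<subseteq> E - A \<Longrightarrow> \<bar>\<mu> B\<bar> \<le> D"
        unfolding unb_def using A(1) EB by (metis linorder_not_less sets.Diff)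
      obtain B where B: "B \<in> sets borel" "B \<subseteq> E" "\<bar>\<mu> B\<bar> > C + D"
        using E unfolding unb_def by blast
      have "\<mu> B = \<mu> (B \<inter> A) + \<mu> (B - A)"
        using signed_measure_split[OF \<mu> B(1) A(1)] .
      moreover have "\<bar>\<mu> (B \<inter> A)\<bar> \<le> C" using C[of "B \<inter> A"] B A by auto
      moreover have "\<bar>\<mu> (B - A)\<bar> \<le> D" using D[of "B - A"] B A by auto
      ultimately show False using B(3) by linarith
    qed
    then show ?thesis
    proof
      assume "unb A" then show ?thesis using A big by blast
    next
      assume "unb (E - A)"
      moreover have "E - (E - A) = A" using A by auto
      ultimately show ?thesis using big by (intro exI[of _ "E - A"]) auto
    qed
  qed
  have "\<not> unb UNIV"
  proof
    assume "unb UNIV"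
    then obtain F where F: "\<And>n. unb (F n)" "\<And>n. F (Suc n) \<subseteq> F n \<and> \<bar>\<mu> (F n - F (Suc n))\<bar> \<ge> 1"
      using dependent_nat_choice[of "\<lambda>_. unb" "\<lambda>_ E F. F \<subseteq> E \<and> \<bar>\<mu> (E - F)\<bar> \<ge> 1"] step by metis
    define D where "D n = F n - F (Suc n)" for n
    have "decseq F" using F(2) by (intro decseq_SucI) auto
    have "D m \<inter> D n = {}" if "m < n" for m n
      using decseqD[OF \<open>decseq F\<close>, of "Suc m" n] that by (auto simp: D_def)
    then have disj: "disjoint_family D"
      unfolding disjoint_family_on_def by (metis Int_commute nat_neq_iff)
    have "range D \<subseteq> sets borel" using F(1) by (auto simp: D_def unb_def)
    \<comment> \<open>The terms of a convergent series tend to 0, which the lower bound 1 on every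
      \<open>\<bar>\<mu> (D n)\<bar>\<close> excludes.\<close>
    from signed_measure_sums[OF \<mu> this disj] have "(\<lambda>n. \<mu> (D n)) \<longlonglongrightarrow> 0"
      by (rule summable_LIMSEQ_zero[OF sums_summable])
    then have "eventually (\<lambda>n. \<bar>\<mu> (D n)\<bar> < 1) sequentially"
      using tendstoD[of _ 0 _ 1] by (force simp: dist_real_def)
    then show False using F(2) by (auto simp: D_def eventually_sequentially not_less[symmetric])
  qed
  then obtain C where C: "\<And>A. A \<in> sets borel \<Longrightarrow> \<bar>\<mu> A\<bar> \<le> C"
    by (auto simp: unb_def not_less)
  have "C \<ge> 0" using C[of "{}"] by auto
  then have "\<bar>\<mu> A\<bar> \<le> C" for A
    using C[of A] signed_measure_notin_borel[OF \<mu>, of A] by (cases "A \<in> sets borel") auto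
  then show thesis using that by blast
qed

text \<open>Grouping the pieces by the sign of \<open>\<mu> (P i)\<close> collapses each group to
  the measure of a single union, so each group contributes at most \<open>C\<close>.\<close>

lemma sum_abs_signed_measure_le:
  assumes \<mu>: "signed_measure \<mu>" and C: "\<And>A. \<bar>\<mu> A\<bar> \<le> C"
    and P: "\<forall>i<n. P i \<in> sets borel" "disjoint_family_on P {..<n::nat}"
  shows "(\<Sum>i<n. \<bar>\<mu> (P i)\<bar>) \<le> 2 * C"
proof -
  define I where "I = {i. i < n \<and> \<mu> (P i) \<ge> 0}"
  define J where "J = {i. i < n \<and> \<mu> (P i) < 0}"
  have fin: "finite I" "finite J" by (auto simp: I_def J_def)
  have "(\<Sum>i<n. \<bar>\<mu> (P i)\<bar>) = (\<Sum>i\<in>I \<union> J. \<bar>\<mu> (P i)\<bar>)"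
    by (rule sum.cong) (auto simp: I_def J_def)
  also have "\<dots> = (\<Sum>i\<in>I. \<bar>\<mu> (P i)\<bar>) + (\<Sum>i\<in>J. \<bar>\<mu> (P i)\<bar>)"
    by (rule sum.union_disjoint) (auto simp: I_def J_def)
  also have "(\<Sum>i\<in>I. \<bar>\<mu> (P i)\<bar>) = (\<Sum>i\<in>I. \<mu> (P i))"
    by (rule sum.cong) (auto simp: I_def)
  also have "\<dots> = \<mu> (\<Union>i\<in>I. P i)"
    using P by (intro signed_measure_finite_UN[symmetric] \<mu> fin)
      (auto simp: I_def disjoint_family_on_def)
  also have "(\<Sum>i\<in>J. \<bar>\<mu> (P i)\<bar>) = - (\<Sum>i\<in>J. \<mu> (P i))"
    unfolding sum_negf[symmetric] by (rule sum.cong) (auto simp: J_def)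
  also have "(\<Sum>i\<in>J. \<mu> (P i)) = \<mu> (\<Union>i\<in>J. P i)"
    using P by (intro signed_measure_finite_UN[symmetric] \<mu> fin)
      (auto simp: J_def disjoint_family_on_def)
  finally show ?thesis
    using C[of "\<Union>i\<in>I. P i"] C[of "\<Union>i\<in>J. P i"] by linarith
qed

text \<open>Together with \<open>abs_le_tv_norm\<close> this makes norm bounds and setwise bounds
  interchangeable up to a factor 2, so that later estimates can be made set by set.\<close>

lemma tv_norm_le:
  assumes "signed_measure \<mu>" "\<And>A. \<bar>\<mu> A\<bar> \<le> C"
  shows "tv_norm \<mu> \<le> 2 * C"
  unfolding tv_norm_def
proof (rule cSup_least)
  show "{\<Sum>i<n. \<bar>\<mu> (P i)\<bar> |(n::nat) P. (\<forall>i<n. P i \<in> sets borel) \<and> disjoint_family_on P {..<n}} \<noteq> {}"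
    by (auto simp: disjoint_family_on_def intro!: exI[of _ "0::nat"])
qed (use sum_abs_signed_measure_le[OF assms] in blast)

text \<open>The set \<open>A\<close> alone is a family of length one. \<open>Sup\<close> on the
  reals is informative only for bounded sets, hence the appeal to
  \<open>signed_measure_bounded\<close>.\<close>

lemma abs_le_tv_norm:
  assumes \<mu>: "signed_measure \<mu>"
  shows "\<bar>\<mu> A\<bar> \<le> tv_norm \<mu>"
proof -
  obtain C where C: "\<And>A. \<bar>\<mu> A\<bar> \<le> C" using signed_measure_bounded[OF \<mu>] by blast
  have *: "\<bar>\<mu> A\<bar> \<le> tv_norm \<mu>" if A: "A \<in> sets borel" for A
    unfolding tv_norm_def
  proof (rule cSup_upper)
    show "\<bar>\<mu> A\<bar> \<in> {\<Sum>i<n. \<bar>\<mu> (P i)\<bar> |(n::nat) P. (\<forall>i<n. P i \<in> sets borel) \<and> disjoint_family_on P {..<n}}"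
      using A by (intro CollectI exI[of _ "1::nat"] exI[of _ "\<lambda>_. A"])
        (auto simp: disjoint_family_on_def)
    show "bdd_above {\<Sum>i<n. \<bar>\<mu> (P i)\<bar> |(n::nat) P. (\<forall>i<n. P i \<in> sets borel) \<and> disjoint_family_on P {..<n}}"
      using sum_abs_signed_measure_le[OF \<mu> C] by (intro bdd_aboveI[of _ "2 * C"]) blast
  qed
  show ?thesis
    using *[of A] *[of "{}"] signed_measure_notin_borel[OF \<mu>, of A]
    by (cases "A \<in> sets borel") auto
qed

lemma tv_norm_nonneg: "signed_measure \<mu> \<Longrightarrow> 0 \<le> tv_norm \<mu>"
  using abs_le_tv_norm[of \<mu> "{}"] by simp

section \<open>Positive measures and a criterion for constructing them\<close>

lemma pos_meas_mono:
  assumes "pos_meas \<mu>" "A \<in> sets borel" "B \<in> sets borel" "A \<subseteq> B"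
  shows "\<mu> A \<le> \<mu> B"
  using signed_measure_Diff[of \<mu> B A] assms unfolding pos_meas_def
  by (metis diff_ge_0_iff_ge)

lemma pos_meas_linear:
  "pos_meas \<mu> \<Longrightarrow> pos_meas \<nu> \<Longrightarrow> 0 \<le> a \<Longrightarrow> 0 \<le> b \<Longrightarrow> pos_meas (\<lambda>A. a * \<mu> A + b * \<nu> A)"
  by (auto simp: pos_meas_def signed_measure_linear)

text \<open>Superadditivity on pairs bounds the partial sums over a disjoint sequence by the value
  on its union. This yields summability and one half of countable additivity, so only the reverse
  inequality has to be supplied, with summability granted.\<close>

lemma pos_measI:
  assumes nonborel: "\<And>A. A \<notin> sets borel \<Longrightarrow> p A = 0"
    and nonneg: "\<And>A. 0 \<le> p A"
    and add: "\<And>A B. A \<in> sets borel \<Longrightarrow> B \<in> sets borel \<Longrightarrow> A \<inter> B = {} \<Longrightarrow> p A + p B \<le> p (A \<union> B)"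
    and sub: "\<And>A. range A \<subseteq> sets borel \<Longrightarrow> disjoint_family A \<Longrightarrow> summable (\<lambda>n. p (A n)) \<Longrightarrow>
      p (\<Union>n::nat. A n) \<le> (\<Sum>n. p (A n))"
  shows "pos_meas p"
  unfolding pos_meas_def signed_measure_def
proof (intro conjI allI impI)
  \<comment> \<open>Superadditivity for the pair \<open>{}\<close>, \<open>{}\<close> reads
    \<open>2 * p {} \<le> p {}\<close>.\<close>
  show "p {} = 0"
    using add[of "{}" "{}"] nonneg[of "{}"] by simp
  have mono: "p A \<le> p B" if "A \<in> sets borel" "B \<in> sets borel" "A \<subseteq> B" for A B
    using add[of A "B - A"] nonneg[of "B - A"] that by (simp add: Un_absorb1)
  fix A :: "nat \<Rightarrow> 'a set"
  assume A: "range A \<subseteq> sets borel" and disj: "disjoint_family A"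
  have le: "(\<Sum>i<n. p (A i)) \<le> p (\<Union>i<n. A i)" for n
  proof (induction n)
    case 0 then show ?case using nonneg by simp
  next
    case (Suc n)
    have "A i \<inter> A n = {}" if "i < n" for i
      using disjoint_family_onD[OF disj, of i n] that by simp
    then have "(\<Union>i<n. A i) \<inter> A n = {}" by blast
    then have "p (\<Union>i<n. A i) + p (A n) \<le> p ((\<Union>i<n. A i) \<union> A n)"
      using A by (intro add) auto
    with Suc show ?case by (simp add: lessThan_Suc Un_commute)
  qed
  have le': "(\<Sum>i<n. p (A i)) \<le> p (\<Union>n. A n)" for n
    using A by (intro order.trans[OF le[of n]] mono) auto
  have sm: "summable (\<lambda>n. p (A n))"
    using nonneg le' by (rule summableI_nonneg_bounded)
  have "p (\<Union>n. A n) = (\<Sum>n. p (A n))"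
    using sub[OF A disj sm] suminf_le_const[OF sm le'] by simp
  then show "(\<lambda>n. p (A n)) sums p (\<Union>n. A n)"
    using sm by (simp add: summable_sums)
qed (use nonborel nonneg in auto)

section \<open>The Jordan decomposition of a signed measure\<close>

lemma jordan_pos_upper:
  assumes "signed_measure \<mu>" "A \<in> sets borel" "B \<in> sets borel" "B \<subseteq> A"
  shows "\<mu> B \<le> jordan_pos \<mu> A"
proof -
  obtain C where C: "\<And>A. \<bar>\<mu> A\<bar> \<le> C" using signed_measure_bounded[OF assms(1)] by blast
  have "bdd_above {\<mu> B |B. B \<in> sets borel \<and> B \<subseteq> A}"
    using C by (intro bdd_aboveI[of _ C]) (auto dest: abs_le_D1)
  then show ?thesis
    using assms by (auto simp: jordan_pos_def intro!: cSup_upper)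
qed

lemma jordan_pos_least:
  assumes "A \<in> sets borel" "\<And>B. B \<in> sets borel \<Longrightarrow> B \<subseteq> A \<Longrightarrow> \<mu> B \<le> c"
  shows "jordan_pos \<mu> A \<le> c"
proof -
  have "{\<mu> B |B. B \<in> sets borel \<and> B \<subseteq> A} \<noteq> {}" using assms(1) by blast
  then show ?thesis
    using assms by (auto simp: jordan_pos_def intro!: cSup_least)
qed

lemma jordan_pos_nonneg:
  assumes "signed_measure \<mu>" shows "0 \<le> jordan_pos \<mu> A"
  using jordan_pos_upper[OF assms, of A "{}"] signed_measure_empty[OF assms]
  by (cases "A \<in> sets borel") (auto simp: jordan_pos_def)

text \<open>Superadditivity comes from uniting subsets of two disjoint sets, countable subadditivity
  from cutting a subset of the union along the sequence.\<close>

lemma pos_meas_jordan_pos: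
  assumes \<mu>: "signed_measure \<mu>"
  shows "pos_meas (jordan_pos \<mu>)"
proof (rule pos_measI)
  fix A B :: "'a set"
  assume AB: "A \<in> sets borel" "B \<in> sets borel" "A \<inter> B = {}"
  have "jordan_pos \<mu> A \<le> jordan_pos \<mu> (A \<union> B) - jordan_pos \<mu> B"
  proof (rule jordan_pos_least[OF AB(1)])
    fix A' assume A': "A' \<in> sets borel" "A' \<subseteq> A"
    \<comment> \<open>The two suprema are taken in turn: with \<open>A'\<close> fixed, first the one
      over all \<open>B'\<close>.\<close>
    have "jordan_pos \<mu> B \<le> jordan_pos \<mu> (A \<union> B) - \<mu> A'"
    proof (rule jordan_pos_least[OF AB(2)])
      fix B' assume B': "B' \<in> sets borel" "B' \<subseteq> B"
      have "\<mu> A' + \<mu> B' = \<mu> (A' \<union> B')"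
        using A' B' AB by (intro signed_measure_Un[OF \<mu>, symmetric]) auto
      also have "\<dots> \<le> jordan_pos \<mu> (A \<union> B)"
        using A' B' AB by (intro jordan_pos_upper[OF \<mu>]) auto
      finally show "\<mu> B' \<le> jordan_pos \<mu> (A \<union> B) - \<mu> A'" by simp
    qed
    then show "\<mu> A' \<le> jordan_pos \<mu> (A \<union> B) - jordan_pos \<mu> B" by simp
  qed
  then show "jordan_pos \<mu> A + jordan_pos \<mu> B \<le> jordan_pos \<mu> (A \<union> B)" by simp
next
  fix A :: "nat \<Rightarrow> 'a set"
  assume A: "range A \<subseteq> sets borel" and disj: "disjoint_family A"
    and sm: "summable (\<lambda>n. jordan_pos \<mu> (A n))"
  show "jordan_pos \<mu> (\<Union>n. A n) \<le> (\<Sum>n. jordan_pos \<mu> (A n))"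
  proof (rule jordan_pos_least)
    fix B assume B: "B \<in> sets borel" "B \<subseteq> (\<Union>n. A n)"
    have "(\<lambda>n. \<mu> (B \<inter> A n)) sums \<mu> (\<Union>n. B \<inter> A n)"
      using A B disj by (intro signed_measure_sums[OF \<mu>]) (auto simp: disjoint_family_on_def, blast)
    moreover have "(\<Union>n. B \<inter> A n) = B" using B by auto
    ultimately have "(\<lambda>n. \<mu> (B \<inter> A n)) sums \<mu> B" by simp
    then show "\<mu> B \<le> (\<Sum>n. jordan_pos \<mu> (A n))"
      by (rule sums_le[OF _ _ summable_sums[OF sm], rotated])
         (use A B in \<open>auto intro!: jordan_pos_upper[OF \<mu>]\<close>)
  qed (use A in auto)
qed (use jordan_pos_nonneg[OF \<mu>] in \<open>auto simp: jordan_pos_def\<close>)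

lemma pos_meas_jordan_neg: "signed_measure \<mu> \<Longrightarrow> pos_meas (jordan_neg \<mu>)"
  unfolding jordan_neg_def by (intro pos_meas_jordan_pos signed_measure_uminus)

text \<open>Complements inside \<open>A\<close> link the two suprema, because
  \<open>\<nu> B = \<nu> A - \<nu> (A - B)\<close>. The resulting inequality, used for
  \<open>\<mu>\<close> and for its negative, gives the equation.\<close>

lemma jordan_decomposition:
  assumes \<mu>: "signed_measure \<mu>"
  shows "\<mu> A = jordan_pos \<mu> A - jordan_neg \<mu> A"
proof (cases "A \<in> sets borel")
  case A: True
  have le: "jordan_pos \<nu> A \<le> \<nu> A + jordan_pos (\<lambda>A. - \<nu> A) A" if \<nu>: "signed_measure \<nu>" for \<nu>
  proof (rule jordan_pos_least[OF A])
    fix B assume B: "B \<in> sets borel" "B \<subseteq> A"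
    have "- \<nu> (A - B) \<le> jordan_pos (\<lambda>A. - \<nu> A) A"
      using jordan_pos_upper[OF signed_measure_uminus[OF \<nu>], of A "A - B"] A B by auto
    then show "\<nu> B \<le> \<nu> A + jordan_pos (\<lambda>A. - \<nu> A) A"
      using signed_measure_Diff[OF \<nu> A B] by simp
  qed
  show ?thesis
    using le[OF \<mu>] le[OF signed_measure_uminus[OF \<mu>]] by (simp add: jordan_neg_def)
qed (use \<mu> in \<open>simp add: jordan_neg_def jordan_pos_def signed_measure_notin_borel\<close>)

lemma jordan_pos_le:
  assumes "\<And>A. \<bar>\<mu> A\<bar> \<le> C"
  shows "jordan_pos \<mu> A \<le> C"
proof (cases "A \<in> sets borel")
  case True
  then show ?thesis using assms by (intro jordan_pos_least) (auto dest: abs_le_D1)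
next
  case False
  then show ?thesis using assms[of "{}"] by (simp add: jordan_pos_def)
qed

lemma jordan_neg_le:
  assumes "\<And>A. \<bar>\<mu> A\<bar> \<le> C"
  shows "jordan_neg \<mu> A \<le> C"
  unfolding jordan_neg_def using assms by (intro jordan_pos_le) auto

subsection \<open>Integration against finite signed measures\<close>

lemma sets_meas_of_fun [simp, measurable_cong]: "sets (meas_of_fun \<nu>) = sets borel"
  using sets.sigma_sets_eq[of borel] by (simp add: meas_of_fun_def)

lemma space_meas_of_fun [simp]: "space (meas_of_fun \<nu>) = UNIV"
  by (simp add: meas_of_fun_def)

lemma emeasure_meas_of_fun:
  assumes p: "pos_meas p"
  shows "emeasure (meas_of_fun p) A = ennreal (p A)"
proof (cases "A \<in> sets borel")
  case True
  show ?thesis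
    unfolding meas_of_fun_def
  proof (rule emeasure_measure_of_sigma)
    show "sigma_algebra UNIV (sets borel :: 'a set set)"
      using sets.sigma_algebra_axioms[of borel] by simp
    show "positive (sets borel) (\<lambda>A. ennreal (p A))"
      using p by (simp add: positive_def pos_meas_def signed_measure_empty)
    show "countably_additive (sets borel) (\<lambda>A. ennreal (p A))"
    proof (rule countably_additiveI)
      fix A :: "nat \<Rightarrow> 'a set"
      assume "range A \<subseteq> sets borel" "disjoint_family A"
      then have "(\<lambda>n. p (A n)) sums p (\<Union>n. A n)"
        using p by (intro signed_measure_sums) (auto simp: pos_meas_def)
      then show "(\<Sum>i. ennreal (p (A i))) = ennreal (p (\<Union> (range A)))"
        using p by (intro suminf_ennreal_eq) (auto simp: pos_meas_def)
    qed
  qed fact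
next
  case False
  then show ?thesis
    using p by (simp add: emeasure_notin_sets pos_meas_def signed_measure_notin_borel)
qed

lemma finite_measure_meas_of_fun: "pos_meas p \<Longrightarrow> finite_measure (meas_of_fun p)"
  by (intro finite_measureI) (simp add: emeasure_meas_of_fun)

lemma measure_meas_of_fun: "pos_meas p \<Longrightarrow> measure (meas_of_fun p) A = p A"
  by (simp add: measure_def emeasure_meas_of_fun pos_meas_def)

lemma integrable_meas_of_fun:
  assumes "pos_meas p" "f \<in> borel_measurable borel" "\<And>x. \<bar>f x\<bar> \<le> (C::real)"
  shows "integrable (meas_of_fun p) f"
  using assms by (intro finite_measure.integrable_const_bound[where B = C] finite_measure_meas_of_fun) auto

text \<open>Linearity in the measure, by induction on the integrand. Nonnegative coefficients keep
  the combination a positive measure.\<close>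

lemma nn_integral_meas_of_fun_linear:
  assumes p: "pos_meas p" and q: "pos_meas q" and ab: "0 \<le> a" "0 \<le> b"
    and f: "f \<in> borel_measurable borel"
  shows "nn_integral (meas_of_fun (\<lambda>A. a * p A + b * q A)) f =
    ennreal a * nn_integral (meas_of_fun p) f + ennreal b * nn_integral (meas_of_fun q) f"
  using f
proof (induction rule: borel_measurable_induct)
  case (cong f g)
  then show ?case by (simp cong: nn_integral_cong)
next
  case (set A)
  have "0 \<le> p A" "0 \<le> q A" using p q by (auto simp: pos_meas_def)
  with set show ?case
    using ab by (simp add: emeasure_meas_of_fun pos_meas_linear p q ennreal_mult)
next
  case (mult v u)
  then have "nn_integral (meas_of_fun \<nu>) (\<lambda>x. u * v x) = u * nn_integral (meas_of_fun \<nu>) v"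
    for \<nu> :: "'a set \<Rightarrow> real"
    by (intro nn_integral_cmult) simp
  then show ?case by (simp only: mult.IH distrib_left mult.left_commute)
next
  case (add u v)
  then have "nn_integral (meas_of_fun \<nu>) (\<lambda>x. v x + u x) =
      nn_integral (meas_of_fun \<nu>) v + nn_integral (meas_of_fun \<nu>) u"
    for \<nu> :: "'a set \<Rightarrow> real"
    by (intro nn_integral_add) simp_all
  then show ?case by (simp only: add.IH distrib_left add_ac)
next
  case (seq U)
  have U: "\<And>i. U i \<in> borel_measurable (meas_of_fun \<nu>)" for \<nu> :: "'a set \<Rightarrow> real"
    using seq by simp
  have "(SUP i. U i) = (\<lambda>x. SUP i. U i x)"
    by (simp add: fun_eq_iff image_comp)
  then have SUP: "nn_integral (meas_of_fun \<nu>) (SUP i. U i) = (SUP i. nn_integral (meas_of_fun \<nu>) (U i))"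
    for \<nu> :: "'a set \<Rightarrow> real"
    using nn_integral_monotone_convergence_SUP[OF seq(3) U] by simp
  \<comment> \<open>The sum of the two suprema is the supremum of the sums because both sequences
    increase.\<close>
  have "incseq (\<lambda>i. nn_integral (meas_of_fun \<nu>) (U i))" for \<nu> :: "'a set \<Rightarrow> real"
    using seq(3) by (auto simp: incseq_def le_fun_def intro!: nn_integral_mono)
  then show ?case
    unfolding SUP seq.IH
    by (subst ennreal_SUP_add) (auto simp: SUP_mult_left_ennreal incseq_def intro!: mult_left_mono)
qed

lemma integral_meas_of_fun_linear:
  assumes p: "pos_meas p" and q: "pos_meas q" and ab: "0 \<le> a" "0 \<le> b"
    and f: "f \<in> borel_measurable borel" and C: "\<And>x. \<bar>f x\<bar> \<le> (C::real)"
  shows "integral\<^sup>L (meas_of_fun (\<lambda>A. a * p A + b * q A)) f =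
    a * integral\<^sup>L (meas_of_fun p) f + b * integral\<^sup>L (meas_of_fun q) f"
proof -
  let ?r = "\<lambda>A. a * p A + b * q A"
  have r: "pos_meas ?r" by (rule pos_meas_linear[OF p q ab])
  have pos: "integral\<^sup>L (meas_of_fun ?r) g =
    a * integral\<^sup>L (meas_of_fun p) g + b * integral\<^sup>L (meas_of_fun q) g"
    if g: "g \<in> borel_measurable borel" "\<And>x. 0 \<le> g x" "\<And>x. g x \<le> C" for g :: "'a \<Rightarrow> real"
  proof -
    have eq: "nn_integral (meas_of_fun \<nu>) g = ennreal (integral\<^sup>L (meas_of_fun \<nu>) g)"
      if "pos_meas \<nu>" for \<nu>
      using g that by (intro nn_integral_eq_integral integrable_meas_of_fun[where C = C]) auto
    have nn: "0 \<le> integral\<^sup>L (meas_of_fun \<nu>) g" for \<nu>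
      using g by (intro integral_nonneg_AE) auto
    have "ennreal (integral\<^sup>L (meas_of_fun ?r) g) =
      ennreal (a * integral\<^sup>L (meas_of_fun p) g + b * integral\<^sup>L (meas_of_fun q) g)"
      using nn_integral_meas_of_fun_linear[OF p q ab, of g] g nn ab
      by (simp add: eq p q r ennreal_mult ennreal_plus)
    then show ?thesis
      using nn ab by (subst (asm) ennreal_inj) (auto intro!: add_nonneg_nonneg mult_nonneg_nonneg)
  qed
  \<comment> \<open>The nonnegative case extends to \<open>f\<close> through its positive and
    negative parts, both bounded by \<open>C\<close>.\<close>
  let ?f1 = "\<lambda>x. max 0 (f x)" and ?f2 = "\<lambda>x. max 0 (- f x)"
  have bnd: "?f1 x \<le> C" "?f2 x \<le> C" for x
    using C[of x] by auto
  have int: "integrable (meas_of_fun \<nu>) ?f1" "integrable (meas_of_fun \<nu>) ?f2" if "pos_meas \<nu>" for \<nu>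
    using f that bnd by (auto intro!: integrable_meas_of_fun[where C = C])
  have parts: "integral\<^sup>L (meas_of_fun \<nu>) f = integral\<^sup>L (meas_of_fun \<nu>) ?f1 - integral\<^sup>L (meas_of_fun \<nu>) ?f2"
    if "pos_meas \<nu>" for \<nu>
  proof -
    have "f = (\<lambda>x. ?f1 x - ?f2 x)" by auto
    then show ?thesis
      using Bochner_Integration.integral_diff[OF int[OF that]] by simp
  qed
  have "integral\<^sup>L (meas_of_fun ?r) ?f1 =
      a * integral\<^sup>L (meas_of_fun p) ?f1 + b * integral\<^sup>L (meas_of_fun q) ?f1"
    "integral\<^sup>L (meas_of_fun ?r) ?f2 =
      a * integral\<^sup>L (meas_of_fun p) ?f2 + b * integral\<^sup>L (meas_of_fun q) ?f2"
    using f bnd by (auto intro!: pos)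
  then show ?thesis
    unfolding parts[OF p] parts[OF q] parts[OF r] by (simp only: algebra_simps)
qed

lemma integral_meas_of_fun_add:
  assumes "pos_meas p" "pos_meas q" "f \<in> borel_measurable borel" "\<And>x. \<bar>f x\<bar> \<le> (C::real)"
  shows "integral\<^sup>L (meas_of_fun (\<lambda>A. p A + q A)) f =
    integral\<^sup>L (meas_of_fun p) f + integral\<^sup>L (meas_of_fun q) f"
  using integral_meas_of_fun_linear[OF assms(1,2) _ _ assms(3,4), of 1 1] by simp

text \<open>Equating \<open>p - q\<close> with the Jordan decomposition and moving the subtracted
  terms across gives two equal sums of positive measures, whose integrals agree. Arbitrary
  decompositions can thus replace the Jordan parts, which are not additive in
  \<open>\<mu>\<close>.\<close>

lemma signed_integral_eq_diff:
  assumes p: "pos_meas p" and q: "pos_meas q"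
    and f: "f \<in> borel_measurable borel" "\<And>x. \<bar>f x\<bar> \<le> (C::real)"
    and eq: "\<And>A. \<mu> A = p A - q A"
  shows "signed_integral f \<mu> = integral\<^sup>L (meas_of_fun p) f - integral\<^sup>L (meas_of_fun q) f"
proof -
  have \<mu>: "signed_measure \<mu>"
    using signed_measure_diff[of p q] p q unfolding pos_meas_def eq[abs_def] by blast
  note j = pos_meas_jordan_pos[OF \<mu>] pos_meas_jordan_neg[OF \<mu>]
  have "(\<lambda>A. jordan_pos \<mu> A + q A) = (\<lambda>A. p A + jordan_neg \<mu> A)"
    using jordan_decomposition[OF \<mu>] eq by (intro ext) (smt (verit))
  then have "integral\<^sup>L (meas_of_fun (jordan_pos \<mu>)) f + integral\<^sup>L (meas_of_fun q) f =
    integral\<^sup>L (meas_of_fun p) f + integral\<^sup>L (meas_of_fun (jordan_neg \<mu>)) f"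
    using integral_meas_of_fun_add[OF j(1) q f] integral_meas_of_fun_add[OF p j(2) f] by simp
  then show ?thesis by (simp add: signed_integral_def)
qed

text \<open>The decomposition is \<open>p - 0\<close>. Writing the zero measure as
  \<open>0 * p + 0 * p\<close> shows that its integral vanishes.\<close>

lemma signed_integral_pos_meas:
  assumes p: "pos_meas p" and f: "f \<in> borel_measurable borel" "\<And>x. \<bar>f x\<bar> \<le> (C::real)"
  shows "signed_integral f p = integral\<^sup>L (meas_of_fun p) f"
proof -
  have "pos_meas (\<lambda>A. 0 :: real)" by (simp add: pos_meas_def signed_measure_def)
  moreover have "integral\<^sup>L (meas_of_fun (\<lambda>A. 0)) f = 0"
    using integral_meas_of_fun_linear[OF p p _ _ f, of 0 0] by simp
  ultimately show ?thesis
    using signed_integral_eq_diff[OF p _ f, of "\<lambda>_. 0" p] by simp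
qed

text \<open>Each of the two terms is written as a difference of positive measures. Adding the
  differences decomposes the whole combination, to which \<open>signed_integral_eq_diff\<close>
  applies.\<close>

lemma signed_integral_linear:
  assumes \<mu>: "signed_measure \<mu>" and \<nu>: "signed_measure \<nu>"
    and f: "f \<in> borel_measurable borel" "\<And>x. \<bar>f x\<bar> \<le> (C::real)"
  shows "signed_integral f (\<lambda>A. a * \<mu> A + b * \<nu> A) = a * signed_integral f \<mu> + b * signed_integral f \<nu>"
proof -
  have *: "\<exists>p q. pos_meas p \<and> pos_meas q \<and> (\<forall>A. c * \<kappa> A = p A - q A) \<and>
    integral\<^sup>L (meas_of_fun p) f - integral\<^sup>L (meas_of_fun q) f = c * signed_integral f \<kappa>"
    if \<kappa>: "signed_measure \<kappa>" for c \<kappa>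
  proof -
    let ?P = "jordan_pos \<kappa>" and ?N = "jordan_neg \<kappa>"
    \<comment> \<open>Positive and negative part of the coefficient: a negative \<open>c\<close>
      exchanges the roles of the Jordan parts.\<close>
    let ?c = "max 0 c" and ?d = "max 0 (- c)"
    note j = pos_meas_jordan_pos[OF \<kappa>] pos_meas_jordan_neg[OF \<kappa>]
    have cd: "0 \<le> ?c" "0 \<le> ?d" by auto
    have c: "c = ?c - ?d" by auto
    show ?thesis
    proof (intro exI conjI allI)
      show "pos_meas (\<lambda>A. ?c * ?P A + ?d * ?N A)" "pos_meas (\<lambda>A. ?d * ?P A + ?c * ?N A)"
        using j cd by (auto intro!: pos_meas_linear)
      show "c * \<kappa> A = ?c * ?P A + ?d * ?N A - (?d * ?P A + ?c * ?N A)" for A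
        unfolding jordan_decomposition[OF \<kappa>, of A] by (subst c) (simp only: algebra_simps)
      show "integral\<^sup>L (meas_of_fun (\<lambda>A. ?c * ?P A + ?d * ?N A)) f -
          integral\<^sup>L (meas_of_fun (\<lambda>A. ?d * ?P A + ?c * ?N A)) f = c * signed_integral f \<kappa>"
        unfolding signed_integral_def integral_meas_of_fun_linear[OF j cd f]
          integral_meas_of_fun_linear[OF j cd(2,1) f]
        \<comment> \<open>The occurrence of \<open>c\<close> to be replaced is the factor on the
          right-hand side; the four before it lie inside \<open>?c\<close> and
          \<open>?d\<close>.\<close>
        by (subst (5) c) (simp only: algebra_simps)
    qed
  qed
  obtain p q where pq: "pos_meas p" "pos_meas q" "\<And>A. a * \<mu> A = p A - q A"
    "integral\<^sup>L (meas_of_fun p) f - integral\<^sup>L (meas_of_fun q) f = a * signed_integral f \<mu>"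
    using *[OF \<mu>, of a] by blast
  obtain r s where rs: "pos_meas r" "pos_meas s" "\<And>A. b * \<nu> A = r A - s A"
    "integral\<^sup>L (meas_of_fun r) f - integral\<^sup>L (meas_of_fun s) f = b * signed_integral f \<nu>"
    using *[OF \<nu>, of b] by blast
  have "pos_meas (\<lambda>A. p A + r A)" "pos_meas (\<lambda>A. q A + s A)"
    using pos_meas_linear[of p r 1 1] pos_meas_linear[of q s 1 1] pq rs by auto
  then have "signed_integral f (\<lambda>A. a * \<mu> A + b * \<nu> A) =
    integral\<^sup>L (meas_of_fun (\<lambda>A. p A + r A)) f - integral\<^sup>L (meas_of_fun (\<lambda>A. q A + s A)) f"
    using pq(3) rs(3) by (intro signed_integral_eq_diff[OF _ _ f]) auto
  then show ?thesis
    using integral_meas_of_fun_add[OF pq(1) rs(1) f] integral_meas_of_fun_add[OF pq(2) rs(2) f] pq(4) rs(4)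
    by simp
qed

lemma signed_integral_diff_fun:
  assumes \<mu>: "signed_measure \<mu>"
    and f: "f \<in> borel_measurable borel" "\<And>x. \<bar>f x\<bar> \<le> (C::real)"
    and g: "g \<in> borel_measurable borel" "\<And>x. \<bar>g x\<bar> \<le> (D::real)"
  shows "signed_integral (\<lambda>x. f x - g x) \<mu> = signed_integral f \<mu> - signed_integral g \<mu>"
  using integrable_meas_of_fun[OF pos_meas_jordan_pos[OF \<mu>] f]
    integrable_meas_of_fun[OF pos_meas_jordan_neg[OF \<mu>] f]
    integrable_meas_of_fun[OF pos_meas_jordan_pos[OF \<mu>] g]
    integrable_meas_of_fun[OF pos_meas_jordan_neg[OF \<mu>] g]
  by (simp add: signed_integral_def)

lemma integral_meas_of_fun_tendsto:
  assumes p: "pos_meas p"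
    and s: "\<And>n. s n \<in> borel_measurable borel" "\<And>n x. \<bar>s n x\<bar> \<le> (C::real)"
    and lim: "\<And>x. (\<lambda>n. s n x) \<longlonglongrightarrow> f x"
  shows "(\<lambda>n. integral\<^sup>L (meas_of_fun p) (s n)) \<longlonglongrightarrow> integral\<^sup>L (meas_of_fun p) f"
proof (rule integral_dominated_convergence[where w = "\<lambda>_. C"])
  show "f \<in> borel_measurable (meas_of_fun p)"
    using borel_measurable_LIMSEQ_real[OF lim s(1)] by simp
  have "0 \<le> C" using s(2)[of 0 undefined] by linarith
  then show "integrable (meas_of_fun p) (\<lambda>_. C)"
    using p by (intro integrable_meas_of_fun[where C = C]) auto
qed (use s lim in auto)

lemma signed_integral_tendsto:
  assumes \<mu>: "signed_measure \<mu>"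
    and s: "\<And>n. s n \<in> borel_measurable borel" "\<And>n x. \<bar>s n x\<bar> \<le> (C::real)"
    and lim: "\<And>x. (\<lambda>n. s n x) \<longlonglongrightarrow> f x"
  shows "(\<lambda>n. signed_integral (s n) \<mu>) \<longlonglongrightarrow> signed_integral f \<mu>"
  unfolding signed_integral_def
  by (intro tendsto_diff integral_meas_of_fun_tendsto[OF _ s lim] pos_meas_jordan_pos
      pos_meas_jordan_neg \<mu>)

text \<open>Each Jordan part has total mass at most \<open>tv_norm \<mu>\<close>; the factor 2
  counts both parts.\<close>

lemma abs_signed_integral_le:
  assumes \<mu>: "signed_measure \<mu>"
    and f: "f \<in> borel_measurable borel" "\<And>x. \<bar>f x\<bar> \<le> (C::real)"
  shows "\<bar>signed_integral f \<mu>\<bar> \<le> 2 * C * tv_norm \<mu>"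
proof -
  have C0: "0 \<le> C" using f(2)[of undefined] by linarith
  have *: "\<bar>integral\<^sup>L (meas_of_fun p) f\<bar> \<le> C * p UNIV" if p: "pos_meas p" for p
  proof -
    have "\<bar>integral\<^sup>L (meas_of_fun p) f\<bar> \<le> integral\<^sup>L (meas_of_fun p) (\<lambda>x. \<bar>f x\<bar>)"
      by (rule integral_abs_bound)
    also have "\<dots> \<le> integral\<^sup>L (meas_of_fun p) (\<lambda>x. C)"
      using p f C0 by (intro integral_mono integrable_meas_of_fun[where C = C]) auto
    also have "\<dots> = C * p UNIV"
      using measure_meas_of_fun[OF p] by simp
    finally show ?thesis .
  qed
  have "C * jordan_pos \<mu> UNIV \<le> C * tv_norm \<mu>" "C * jordan_neg \<mu> UNIV \<le> C * tv_norm \<mu>"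
    using C0 jordan_pos_le[OF abs_le_tv_norm[OF \<mu>]] jordan_neg_le[OF abs_le_tv_norm[OF \<mu>]]
    by (auto intro!: mult_left_mono)
  then show ?thesis
    using *[OF pos_meas_jordan_pos[OF \<mu>]] *[OF pos_meas_jordan_neg[OF \<mu>]]
    unfolding signed_integral_def by linarith
qed

subsection \<open>Kernels and their operators\<close>

lemma bounded_kernelI:
  assumes "\<And>x. signed_measure (k x)"
    and "\<And>A. A \<in> sets borel \<Longrightarrow> (\<lambda>x. k x A) \<in> borel_measurable borel"
    and "\<And>x A. \<bar>k x A\<bar> \<le> C"
  shows "bounded_kernel k"
  unfolding bounded_kernel_def using assms tv_norm_le[OF assms(1,3)] by blast

lemma bounded_kernel_signed_measure: "bounded_kernel k \<Longrightarrow> signed_measure (k x)"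
  by (simp add: bounded_kernel_def)

lemma bounded_kernel_measurable:
  "bounded_kernel k \<Longrightarrow> (\<lambda>x. k x A) \<in> borel_measurable borel"
  by (cases "A \<in> sets borel") (simp_all add: bounded_kernel_def signed_measure_notin_borel)

lemma bounded_kernel_bound:
  assumes "bounded_kernel k"
  obtains C where "\<And>x A. \<bar>k x A\<bar> \<le> C"
proof -
  obtain C where "\<And>x. tv_norm (k x) \<le> C"
    using assms unfolding bounded_kernel_def by blast
  then show thesis
    using that abs_le_tv_norm[OF bounded_kernel_signed_measure[OF assms]] by (blast intro: order.trans)
qed

lemma bounded_kernel_add:
  assumes k: "bounded_kernel k" and l: "bounded_kernel l"
  shows "bounded_kernel (\<lambda>x A. k x A + l x A)"
proof -
  obtain C where C: "\<And>x A. \<bar>k x A\<bar> \<le> C" using bounded_kernel_bound[OF k] by blast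
  obtain D where D: "\<And>x A. \<bar>l x A\<bar> \<le> D" using bounded_kernel_bound[OF l] by blast
  show ?thesis
  proof (rule bounded_kernelI)
    show "\<bar>k x A + l x A\<bar> \<le> C + D" for x A using C[of x A] D[of x A] by linarith
  qed (intro signed_measure_add bounded_kernel_signed_measure borel_measurable_add
      bounded_kernel_measurable k l)+
qed

lemma bounded_kernel_diff:
  assumes k: "bounded_kernel k" and l: "bounded_kernel l"
  shows "bounded_kernel (\<lambda>x A. k x A - l x A)"
proof -
  obtain C where C: "\<And>x A. \<bar>k x A\<bar> \<le> C" using bounded_kernel_bound[OF k] by blast
  obtain D where D: "\<And>x A. \<bar>l x A\<bar> \<le> D" using bounded_kernel_bound[OF l] by blast
  show ?thesis
  proof (rule bounded_kernelI)
    show "\<bar>k x A - l x A\<bar> \<le> C + D" for x A using C[of x A] D[of x A] by linarith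
  qed (intro signed_measure_diff bounded_kernel_signed_measure borel_measurable_diff
      bounded_kernel_measurable k l)+
qed

definition kernel_op ::
  "('a::topological_space \<Rightarrow> 'a set \<Rightarrow> real) \<Rightarrow> ('a set \<Rightarrow> real) \<Rightarrow> ('a set \<Rightarrow> real)" where
  "kernel_op k \<mu> A = signed_integral (\<lambda>x. k x A) \<mu>"

lemma kernel_op_diff:
  assumes k: "bounded_kernel k" and l: "bounded_kernel l" and \<mu>: "signed_measure \<mu>"
  shows "kernel_op (\<lambda>x A. k x A - l x A) \<mu> A = kernel_op k \<mu> A - kernel_op l \<mu> A"
proof -
  obtain C where C: "\<And>x A. \<bar>k x A\<bar> \<le> C" using bounded_kernel_bound[OF k] by blast
  obtain D where D: "\<And>x A. \<bar>l x A\<bar> \<le> D" using bounded_kernel_bound[OF l] by blast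
  show ?thesis
    unfolding kernel_op_def
    by (rule signed_integral_diff_fun[OF \<mu> bounded_kernel_measurable[OF k] C
          bounded_kernel_measurable[OF l] D])
qed

lemma kernel_op_pos_meas:
  assumes k: "bounded_kernel k" and \<mu>: "pos_meas \<mu>"
  shows "kernel_op k \<mu> A = integral\<^sup>L (meas_of_fun \<mu>) (\<lambda>x. k x A)"
proof -
  obtain C where C: "\<And>x A. \<bar>k x A\<bar> \<le> C" using bounded_kernel_bound[OF k] by blast
  show ?thesis
    unfolding kernel_op_def
    by (rule signed_integral_pos_meas[OF \<mu> bounded_kernel_measurable[OF k] C])
qed

lemma kernel_op_mono:
  assumes k: "bounded_kernel k" and l: "bounded_kernel l" and le: "\<And>x A. k x A \<le> l x A"
  shows "op_le (kernel_op k) (kernel_op l)"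
  unfolding op_le_def meas_le_def
proof (intro allI impI)
  fix \<mu> :: "'a set \<Rightarrow> real" and A
  assume \<mu>: "pos_meas \<mu>"
  obtain C where C: "\<And>x A. \<bar>k x A\<bar> \<le> C" using bounded_kernel_bound[OF k] by blast
  obtain D where D: "\<And>x A. \<bar>l x A\<bar> \<le> D" using bounded_kernel_bound[OF l] by blast
  show "kernel_op k \<mu> A \<le> kernel_op l \<mu> A"
    unfolding kernel_op_pos_meas[OF k \<mu>] kernel_op_pos_meas[OF l \<mu>]
    by (intro integral_mono le integrable_meas_of_fun[OF \<mu> bounded_kernel_measurable[OF k] C]
        integrable_meas_of_fun[OF \<mu> bounded_kernel_measurable[OF l] D])
qed

section \<open>Bounded operators on the space of measures\<close>

lemma bounded_opI:
  assumes meas: "\<And>\<mu>. signed_measure \<mu> \<Longrightarrow> signed_measure (T \<mu>)"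
    and lin: "\<And>\<mu> \<nu> a b. signed_measure \<mu> \<Longrightarrow> signed_measure \<nu> \<Longrightarrow>
      T (\<lambda>A. a * \<mu> A + b * \<nu> A) = (\<lambda>A. a * T \<mu> A + b * T \<nu> A)"
    and bnd: "\<And>\<mu> A. signed_measure \<mu> \<Longrightarrow> \<bar>T \<mu> A\<bar> \<le> C * tv_norm \<mu>"
  shows "bounded_op T"
proof -
  have "tv_norm (T \<mu>) \<le> (2 * C) * tv_norm \<mu>" if "signed_measure \<mu>" for \<mu>
    using tv_norm_le[OF meas[OF that] bnd[OF that]] by simp
  then show ?thesis
    unfolding bounded_op_def Meas_def using meas lin by blast
qed

lemma bounded_op_signed_measure: "bounded_op T \<Longrightarrow> signed_measure \<mu> \<Longrightarrow> signed_measure (T \<mu>)"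
  by (simp add: bounded_op_def Meas_def)

lemma bounded_op_linear:
  "bounded_op T \<Longrightarrow> signed_measure \<mu> \<Longrightarrow> signed_measure \<nu> \<Longrightarrow>
    T (\<lambda>A. a * \<mu> A + b * \<nu> A) = (\<lambda>A. a * T \<mu> A + b * T \<nu> A)"
  by (simp add: bounded_op_def Meas_def)

lemma bounded_op_bound:
  assumes "bounded_op T"
  obtains C where "\<And>\<mu> A. signed_measure \<mu> \<Longrightarrow> \<bar>T \<mu> A\<bar> \<le> C * tv_norm \<mu>"
proof -
  obtain C where "\<And>\<mu>. signed_measure \<mu> \<Longrightarrow> tv_norm (T \<mu>) \<le> C * tv_norm \<mu>"
    using assms unfolding bounded_op_def Meas_def by blast
  then show thesis
    using that abs_le_tv_norm[OF bounded_op_signed_measure[OF assms]] by (blast intro: order.trans)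
qed

lemma bounded_op_diff:
  assumes S: "bounded_op S" and T: "bounded_op T"
  shows "bounded_op (\<lambda>\<mu> A. S \<mu> A - T \<mu> A)"
proof -
  obtain C where C: "\<And>\<mu> A. signed_measure \<mu> \<Longrightarrow> \<bar>S \<mu> A\<bar> \<le> C * tv_norm \<mu>"
    using bounded_op_bound[OF S] by blast
  obtain D where D: "\<And>\<mu> A. signed_measure \<mu> \<Longrightarrow> \<bar>T \<mu> A\<bar> \<le> D * tv_norm \<mu>"
    using bounded_op_bound[OF T] by blast
  show ?thesis
  proof (rule bounded_opI[where C = "C + D"])
    show "\<bar>S \<mu> A - T \<mu> A\<bar> \<le> (C + D) * tv_norm \<mu>" if "signed_measure \<mu>" for \<mu> A
      using C[OF that, of A] D[OF that, of A] unfolding distrib_right by linarith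
  qed (use S T in \<open>auto simp: bounded_op_linear algebra_simps
      intro!: signed_measure_diff intro: bounded_op_signed_measure\<close>)
qed

text \<open>Countable additivity of each \<open>k x\<close> is convergence along partial unions, and
  the uniform bound on \<open>k\<close> carries this through the integral by dominated
  convergence.\<close>

lemma signed_measure_kernel_op:
  assumes k: "bounded_kernel k" and \<mu>: "signed_measure \<mu>"
  shows "signed_measure (kernel_op k \<mu>)"
proof -
  obtain C where C: "\<And>x A. \<bar>k x A\<bar> \<le> C" using bounded_kernel_bound[OF k] by blast
  note ks = bounded_kernel_signed_measure[OF k]
  note km = bounded_kernel_measurable[OF k]
  have zero: "kernel_op k \<mu> A = 0" if "\<And>x. k x A = 0" for A
    using that by (simp add: kernel_op_def signed_integral_def)
  \<comment> \<open>Additivity is read off from the difference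
    \<open>k x (A \<union> B) - k x B = k x A\<close>.\<close>
  have Un: "kernel_op k \<mu> (A \<union> B) = kernel_op k \<mu> A + kernel_op k \<mu> B"
    if "A \<in> sets borel" "B \<in> sets borel" "A \<inter> B = {}" for A B
    using signed_integral_diff_fun[OF \<mu> km[of "A \<union> B"] C km[of B] C] that
    by (simp add: kernel_op_def signed_measure_Un[OF ks])
  show ?thesis
    unfolding signed_measure_def
  proof (intro conjI allI impI)
    show empty: "kernel_op k \<mu> {} = 0"
      by (intro zero signed_measure_empty ks)
    fix A :: "nat \<Rightarrow> 'a set"
    assume A: "range A \<subseteq> sets borel" and disj: "disjoint_family A"
    have sum: "(\<Sum>i<n. k x (A i)) = k x (\<Union>i<n. A i)" for n x
      using A disj by (intro signed_measure_finite_UN[OF ks, symmetric])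
        (auto intro: disjoint_family_on_mono[OF subset_UNIV])
    have "(\<lambda>n. kernel_op k \<mu> (\<Union>i<n. A i)) \<longlonglongrightarrow> kernel_op k \<mu> (\<Union>n. A n)"
      unfolding kernel_op_def
    proof (rule signed_integral_tendsto[OF \<mu> km C])
      fix x
      show "(\<lambda>n. k x (\<Union>i<n. A i)) \<longlonglongrightarrow> k x (\<Union>n. A n)"
        using signed_measure_sums[OF ks A disj, of x] unfolding sums_def sum .
    qed
    moreover have "kernel_op k \<mu> (\<Union>i<n. A i) = (\<Sum>i<n. kernel_op k \<mu> (A i))" for n
    proof (induction n)
      case 0 then show ?case using empty by simp
    next
      case (Suc n)
      have "A i \<inter> A n = {}" if "i < n" for i
        using disjoint_family_onD[OF disj, of i n] that by simp
      then have "(\<Union>i<n. A i) \<inter> A n = {}" by blast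
      then have "kernel_op k \<mu> ((\<Union>i<n. A i) \<union> A n) = kernel_op k \<mu> (\<Union>i<n. A i) + kernel_op k \<mu> (A n)"
        using A by (intro Un) auto
      with Suc show ?case by (simp add: lessThan_Suc Un_commute)
    qed
    ultimately show "(\<lambda>n. kernel_op k \<mu> (A n)) sums kernel_op k \<mu> (\<Union>n. A n)"
      by (simp add: sums_def)
  qed (use signed_measure_notin_borel[OF ks] in \<open>auto intro: zero\<close>)
qed

lemma bounded_op_kernel_op:
  assumes k: "bounded_kernel k"
  shows "bounded_op (kernel_op k)"
proof -
  obtain C where C: "\<And>x A. \<bar>k x A\<bar> \<le> C" using bounded_kernel_bound[OF k] by blast
  show ?thesis
  proof (rule bounded_opI[where C = "2 * C"])
    show "\<bar>kernel_op k \<mu> A\<bar> \<le> 2 * C * tv_norm \<mu>" if "signed_measure \<mu>" for \<mu> A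
      unfolding kernel_op_def by (rule abs_signed_integral_le[OF that bounded_kernel_measurable[OF k] C])
    show "kernel_op k (\<lambda>A. a * \<mu> A + b * \<nu> A) = (\<lambda>A. a * kernel_op k \<mu> A + b * kernel_op k \<nu> A)"
      if "signed_measure \<mu>" "signed_measure \<nu>" for \<mu> \<nu> a b
      unfolding kernel_op_def
      by (intro ext signed_integral_linear[OF that bounded_kernel_measurable[OF k] C])
  qed (rule signed_measure_kernel_op[OF k])
qed

lemma weakly_continuous_kernel_op: "bounded_kernel k \<Longrightarrow> weakly_continuous (kernel_op k)"
  unfolding weakly_continuous_def using bounded_op_kernel_op by (auto simp: kernel_op_def)

text \<open>Weak continuity describes \<open>T \<mu>\<close> on Borel sets only. Elsewhere both
  sides vanish, being signed measures, so they agree as set functions.\<close>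

lemma weakly_continuous_imp_kernel_op:
  assumes "weakly_continuous T"
  obtains k where "bounded_kernel k" "\<And>\<mu>. signed_measure \<mu> \<Longrightarrow> T \<mu> = kernel_op k \<mu>"
proof -
  obtain k where k: "bounded_kernel k"
    and eq: "\<And>\<mu> A. signed_measure \<mu> \<Longrightarrow> A \<in> sets borel \<Longrightarrow> T \<mu> A = kernel_op k \<mu> A"
    using assms unfolding weakly_continuous_def Meas_def kernel_op_def by blast
  have "T \<mu> A = kernel_op k \<mu> A" if \<mu>: "signed_measure \<mu>" for \<mu> A
  proof (cases "A \<in> sets borel")
    case False
    have "bounded_op T" using assms by (simp add: weakly_continuous_def)
    then show ?thesis
      using signed_measure_notin_borel[OF signed_measure_kernel_op[OF k \<mu>] False]
        signed_measure_notin_borel[OF bounded_op_signed_measure[OF _ \<mu>] False] by simp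
  qed (use eq \<mu> in auto)
  with k show thesis using that by blast
qed

text \<open>The value is 0 on a non-Borel set even if it contains \<open>x\<close>, following the
  convention of \<open>signed_measure\<close>.\<close>

definition dirac :: "'a::topological_space \<Rightarrow> 'a set \<Rightarrow> real" where
  "dirac x A = (if A \<in> sets borel \<and> x \<in> A then 1 else 0)"

lemma pos_meas_dirac: "pos_meas (dirac x)"
proof (rule pos_measI)
  fix A :: "nat \<Rightarrow> 'a set"
  assume A: "range A \<subseteq> sets borel" and sm: "summable (\<lambda>n. dirac x (A n))"
  show "dirac x (\<Union>n. A n) \<le> (\<Sum>n. dirac x (A n))"
  proof (cases "\<exists>n. x \<in> A n")
    case True
    then obtain n where n: "x \<in> A n" by blast
    have "dirac x (A n) \<le> (\<Sum>n. dirac x (A n))"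
      using sum_le_suminf[OF sm, of "{n}"] by (simp add: dirac_def)
    moreover have "dirac x (A n) = 1" using n A by (auto simp: dirac_def)
    ultimately show ?thesis by (auto simp: dirac_def)
  next
    case False
    then show ?thesis by (simp add: dirac_def)
  qed
qed (auto simp: dirac_def)

lemma tv_norm_dirac_le: "tv_norm (dirac x) \<le> 2"
proof -
  have "signed_measure (dirac x)" using pos_meas_dirac[of x] by (simp add: pos_meas_def)
  moreover have "\<bar>dirac x A\<bar> \<le> 1" for A by (simp add: dirac_def)
  ultimately show ?thesis using tv_norm_le[of "dirac x" 1] by simp
qed

text \<open>Points are closed in a T1 space, so the complement of \<open>{x}\<close> is a null set
  of \<open>dirac x\<close>. This recovers a kernel from its operator and turns operator
  inequalities into pointwise ones.\<close>

lemma kernel_op_dirac: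
  fixes x :: "'a::t1_space"
  assumes k: "bounded_kernel k"
  shows "kernel_op k (dirac x) A = k x A"
proof -
  have "AE y in meas_of_fun (dirac x). y = x"
    by (rule AE_I[where N = "- {x}"]) (auto simp: emeasure_meas_of_fun pos_meas_dirac dirac_def)
  then have "integral\<^sup>L (meas_of_fun (dirac x)) (\<lambda>y. k y A) = integral\<^sup>L (meas_of_fun (dirac x)) (\<lambda>_. k x A)"
    using bounded_kernel_measurable[OF k] by (intro integral_cong_AE) auto
  then show ?thesis
    using kernel_op_pos_meas[OF k pos_meas_dirac] measure_meas_of_fun[OF pos_meas_dirac, of x UNIV]
    by (simp add: dirac_def)
qed

subsection \<open>The positive part of a kernel\<close>

lemma pos_meas_outer_regular:
  fixes p :: "'a::polish_space set \<Rightarrow> real"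
  assumes p: "pos_meas p" and B: "B \<in> sets borel" and e: "0 < e"
  obtains U where "open U" "B \<subseteq> U" "p U < p B + e"
proof -
  have "emeasure (meas_of_fun p) B = (INF U \<in> {U. B \<subseteq> U \<and> open U}. emeasure (meas_of_fun p) U)"
    using B by (intro outer_regular) (simp_all add: emeasure_meas_of_fun[OF p])
  moreover have "emeasure (meas_of_fun p) B < ennreal (p B + e)"
    using e p by (simp add: emeasure_meas_of_fun ennreal_less_iff pos_meas_def)
  ultimately obtain U where U: "B \<subseteq> U" "open U" "emeasure (meas_of_fun p) U < ennreal (p B + e)"
    by (auto simp: INF_less_iff)
  moreover have "p U < p B + e"
    using U(3) p by (simp add: emeasure_meas_of_fun ennreal_less_iff pos_meas_def)
  ultimately show thesis using that by blast
qed

text \<open>The family is fixed before \<open>p\<close>, \<open>B\<close> and \<open>e\<close>, so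
  it serves all measures \<open>q x\<close> of a kernel at once. Outer regularity gives an open
  \<open>U\<close> slightly larger than \<open>B\<close>, and continuity from below a finite union
  of basic sets that nearly fills \<open>U\<close>; each error is below
  \<open>e / 2\<close>.\<close>

lemma countable_family_approximating_borel:
  obtains W :: "nat \<Rightarrow> 'a::polish_space set"
  where "\<And>j. W j \<in> sets borel"
    and "\<And>p B e. pos_meas p \<Longrightarrow> B \<in> sets borel \<Longrightarrow> 0 < e \<Longrightarrow> \<exists>j. p (W j - B) + p (B - W j) < e"
proof -
  obtain \<B> :: "'a set set" where \<B>: "countable \<B>" "topological_basis \<B>"
    using ex_countable_basis by blast
  define \<W> where "\<W> = Union ` {F. finite F \<and> F \<subseteq> \<B>}"
  have "countable \<W>"
    unfolding \<W>_def using \<B>(1) by (intro countable_image countable_Collect_finite_subset)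
  moreover have ne: "\<W> \<noteq> {}" by (auto simp: \<W>_def)
  ultimately have W: "range (from_nat_into \<W>) = \<W>" by (rule range_from_nat_into[rotated])
  have WB: "A \<in> sets borel" if "A \<in> \<W>" for A
    using that topological_basis_open[OF \<B>(2)] by (auto simp: \<W>_def subset_eq)
  show thesis
  proof (rule that)
    show "from_nat_into \<W> j \<in> sets borel" for j
      using WB from_nat_into[OF ne] by blast
    fix p :: "'a set \<Rightarrow> real" and B :: "'a set" and e :: real
    assume p: "pos_meas p" and B: "B \<in> sets borel" and e: "0 < e"
    have ps: "signed_measure p" using p by (simp add: pos_meas_def)
    obtain U where U: "open U" "B \<subseteq> U" "p U < p B + e / 2"
      using pos_meas_outer_regular[OF p B, of "e / 2"] e by auto
    have "\<exists>A\<in>\<W>. A \<subseteq> U \<and> p U < p A + e / 2"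
    \<comment> \<open>For empty \<open>U\<close> the covering subfamily may be empty, whereas
      \<open>from_nat_into\<close> enumerates nonempty sets only.\<close>
    proof (cases "U = {}")
      case True
      then show ?thesis
        using e by (intro bexI[of _ "{}"]) (auto simp: \<W>_def intro!: image_eqI[of _ _ "{}"])
    next
      case False
      obtain B' where B': "B' \<subseteq> \<B>" "\<Union>B' = U"
        using \<B>(2) U(1) unfolding topological_basis_def by blast
      have B'ne: "B' \<noteq> {}" using B' False by blast
      have B'c: "countable B'" using B'(1) \<B>(1) by (rule countable_subset)
      define A where "A n = \<Union>(from_nat_into B' ` {..<n})" for n
      have AW: "A n \<in> \<W>" for n
        unfolding A_def \<W>_def using from_nat_into[OF B'ne] B'(1) by (intro imageI) auto
      have UA: "(\<Union>n. A n) = U"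
      proof -
        have "(\<Union>n. A n) = \<Union>(range (from_nat_into B'))"
          unfolding A_def by blast
        then show ?thesis using range_from_nat_into[OF B'ne B'c] B'(2) by simp
      qed
      have "incseq A"
        unfolding incseq_def A_def by (intro allI impI Union_mono image_mono) auto
      then have "(\<lambda>n. measure (meas_of_fun p) (A n)) \<longlonglongrightarrow> measure (meas_of_fun p) (\<Union>n. A n)"
        using AW WB by (intro finite_measure.finite_Lim_measure_incseq finite_measure_meas_of_fun p) auto
      then have "(\<lambda>n. p (A n)) \<longlonglongrightarrow> p U"
        by (simp only: measure_meas_of_fun[OF p] UA)
      then have "eventually (\<lambda>n. p U - e / 2 < p (A n)) sequentially"
        using e by (intro order_tendstoD) auto
      then obtain n where "p U - e / 2 < p (A n)"
        by (auto simp: eventually_sequentially)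
      then show ?thesis using AW UA by (intro bexI[of _ "A n"]) auto
    qed
    then obtain A where A: "A \<in> \<W>" "A \<subseteq> U" "p U < p A + e / 2" by blast
    have UB: "U \<in> sets borel" using U(1) by simp
    have "p (A - B) \<le> p (U - B)" "p (B - A) \<le> p (U - A)"
      using A U B UB WB by (auto intro!: pos_meas_mono[OF p])
    then have "p (A - B) + p (B - A) < e"
      using signed_measure_Diff[OF ps UB B U(2)] signed_measure_Diff[OF ps UB WB[OF A(1)] A(2)] A(3) U(3)
      by linarith
    then show "\<exists>j. p (from_nat_into \<W> j - B) + p (B - from_nat_into \<W> j) < e"
      using A(1) W by (metis rangeE)
  qed
qed

text \<open>The start value 0 accounts for the empty subset in the supremum that defines
  \<open>jordan_pos\<close>; the index bound is exclusive.\<close>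

primrec max_upto :: "(nat \<Rightarrow> real) \<Rightarrow> nat \<Rightarrow> real" where
  "max_upto a 0 = 0"
| "max_upto a (Suc n) = max (max_upto a n) (a n)"

lemma max_upto_nonneg: "0 \<le> max_upto a n"
  by (induction n) auto

lemma max_upto_le: "(\<And>j. a j \<le> C) \<Longrightarrow> 0 \<le> C \<Longrightarrow> max_upto a n \<le> C"
  by (induction n) auto

lemma le_max_upto: "j < n \<Longrightarrow> a j \<le> max_upto a n"
  by (induction n) (auto simp: less_Suc_eq)

lemma borel_measurable_max_upto:
  "(\<And>j. (\<lambda>x. a x j) \<in> borel_measurable M) \<Longrightarrow> (\<lambda>x. max_upto (a x) n) \<in> borel_measurable M"
  by (induction n) auto

text \<open>Replacing a Borel subset \<open>B\<close> of \<open>A\<close> by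
  \<open>A \<inter> W j\<close> changes \<open>\<nu>\<close> by at most the total variation of the
  symmetric difference of \<open>B\<close> and \<open>W j\<close>, which can be made arbitrarily
  small. The family depends neither on \<open>\<nu>\<close> nor on \<open>A\<close>.\<close>

lemma jordan_pos_eq_countable_sup:
  obtains W :: "nat \<Rightarrow> 'a::polish_space set"
  where "\<And>j. W j \<in> sets borel"
    and "\<And>\<nu> A. signed_measure \<nu> \<Longrightarrow> A \<in> sets borel \<Longrightarrow>
      max_upto (\<lambda>j. \<nu> (A \<inter> W j)) \<longlonglongrightarrow> jordan_pos \<nu> A"
proof -
  obtain W :: "nat \<Rightarrow> 'a set" where W: "\<And>j. W j \<in> sets borel"
    and approx: "\<And>p B e. pos_meas p \<Longrightarrow> B \<in> sets borel \<Longrightarrow> 0 < e \<Longrightarrow> \<exists>j. p (W j - B) + p (B - W j) < e"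
    by (rule countable_family_approximating_borel) (rule that)
  show thesis
  proof (rule that)
    fix \<nu> :: "'a set \<Rightarrow> real" and A :: "'a set"
    assume \<nu>: "signed_measure \<nu>" and A: "A \<in> sets borel"
    \<comment> \<open>The total variation measure of \<open>\<nu>\<close>; the factors 1 match the
      form of \<open>pos_meas_linear\<close>.\<close>
    define p where "p A = 1 * jordan_pos \<nu> A + 1 * jordan_neg \<nu> A" for A
    have p: "pos_meas p"
      unfolding p_def by (intro pos_meas_linear pos_meas_jordan_pos pos_meas_jordan_neg \<nu>) auto
    have \<nu>p: "\<bar>\<nu> D\<bar> \<le> p D" for D
      using jordan_decomposition[OF \<nu>, of D] pos_meas_jordan_pos[OF \<nu>] pos_meas_jordan_neg[OF \<nu>]
      unfolding p_def pos_meas_def by (smt (verit))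
    show "max_upto (\<lambda>j. \<nu> (A \<inter> W j)) \<longlonglongrightarrow> jordan_pos \<nu> A"
    proof (rule increasing_tendsto)
      show "eventually (\<lambda>n. max_upto (\<lambda>j. \<nu> (A \<inter> W j)) n \<le> jordan_pos \<nu> A) sequentially"
        using A W by (intro always_eventually allI max_upto_le jordan_pos_nonneg[OF \<nu>]
            jordan_pos_upper[OF \<nu>]) auto
      fix c assume c: "c < jordan_pos \<nu> A"
      then obtain B where B: "B \<in> sets borel" "B \<subseteq> A" "c < \<nu> B"
        using jordan_pos_least[OF A, of \<nu> c] by (meson linorder_not_less)
      \<comment> \<open>The excess of \<open>\<nu> B\<close> over \<open>c\<close> is the admissible
        error, so \<open>\<nu> (A \<inter> W j)\<close> still exceeds \<open>c\<close>.\<close>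
      obtain j where j: "p (W j - B) + p (B - W j) < \<nu> B - c"
        using approx[OF p B(1), of "\<nu> B - c"] B(3) by auto
      have "\<nu> (A \<inter> W j) = \<nu> (B \<inter> W j) + \<nu> (A \<inter> W j - B)"
      proof -
        have "A \<inter> W j \<inter> B = B \<inter> W j" using B(2) by auto
        then show ?thesis using signed_measure_split[OF \<nu>, of "A \<inter> W j" B] A B W by auto
      qed
      moreover have "\<nu> B = \<nu> (B \<inter> W j) + \<nu> (B - W j)"
        by (rule signed_measure_split[OF \<nu> B(1) W])
      moreover have "p (A \<inter> W j - B) \<le> p (W j - B)"
        using A B W by (intro pos_meas_mono[OF p]) auto
      ultimately have "c < \<nu> (A \<inter> W j)"
        using \<nu>p[of "A \<inter> W j - B"] \<nu>p[of "B - W j"] j by linarith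
      then show "eventually (\<lambda>n. c < max_upto (\<lambda>j. \<nu> (A \<inter> W j)) n) sequentially"
        unfolding eventually_sequentially
        by (intro exI[of _ "Suc j"] allI impI)
           (rule less_le_trans[OF _ le_max_upto[of j _ "\<lambda>j. \<nu> (A \<inter> W j)"]], auto)
    qed
  qed (rule W)
qed

text \<open>The issue is measurability in \<open>x\<close>, as the supremum ranges over all Borel
  subsets. Since \<open>W\<close> does not depend on \<open>x\<close>, it becomes a pointwise limit
  of maxima of finitely many measurable functions.\<close>

lemma bounded_kernel_jordan_pos:
  fixes q :: "'a::polish_space \<Rightarrow> 'a set \<Rightarrow> real"
  assumes q: "bounded_kernel q"
  shows "bounded_kernel (\<lambda>x. jordan_pos (q x))"
proof -
  obtain C where C: "\<And>x A. \<bar>q x A\<bar> \<le> C" using bounded_kernel_bound[OF q] by blast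
  note qs = bounded_kernel_signed_measure[OF q]
  show ?thesis
  proof (rule bounded_kernelI)
    show "signed_measure (jordan_pos (q x))" for x
      using pos_meas_jordan_pos[OF qs] by (simp add: pos_meas_def)
    show "\<bar>jordan_pos (q x) A\<bar> \<le> C" for x A
      using jordan_pos_le[OF C] jordan_pos_nonneg[OF qs] by simp
    obtain W :: "nat \<Rightarrow> 'a set" where lim: "\<And>\<nu> A. signed_measure \<nu> \<Longrightarrow> A \<in> sets borel \<Longrightarrow>
      max_upto (\<lambda>j. \<nu> (A \<inter> W j)) \<longlonglongrightarrow> jordan_pos \<nu> A"
      by (rule jordan_pos_eq_countable_sup) (rule that)
    show "(\<lambda>x. jordan_pos (q x) A) \<in> borel_measurable borel" if A: "A \<in> sets borel" for A
    proof (rule borel_measurable_LIMSEQ_real)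
      show "(\<lambda>n. max_upto (\<lambda>j. q x (A \<inter> W j)) n) \<longlonglongrightarrow> jordan_pos (q x) A" for x
        by (rule lim[OF qs A])
      show "(\<lambda>x. max_upto (\<lambda>j. q x (A \<inter> W j)) n) \<in> borel_measurable borel" for n
        by (rule borel_measurable_max_upto[OF bounded_kernel_measurable[OF q]])
    qed
  qed
qed

text \<open>The case distinction secures the value 0 on a non-Borel \<open>A\<close>, for which
  \<open>A \<inter> E\<close> may still be Borel.\<close>

definition restrict_meas :: "('a::topological_space set \<Rightarrow> real) \<Rightarrow> 'a set \<Rightarrow> 'a set \<Rightarrow> real" where
  "restrict_meas \<mu> E A = (if A \<in> sets borel then \<mu> (A \<inter> E) else 0)"

lemma pos_meas_restrict_meas:
  assumes \<mu>: "pos_meas \<mu>" and E: "E \<in> sets borel"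
  shows "pos_meas (restrict_meas \<mu> E)"
  unfolding pos_meas_def signed_measure_def
proof (intro conjI allI impI)
  have \<mu>s: "signed_measure \<mu>" using \<mu> by (simp add: pos_meas_def)
  fix A :: "nat \<Rightarrow> 'a set"
  assume A: "range A \<subseteq> sets borel" and disj: "disjoint_family A"
  have "disjoint_family (\<lambda>n. A n \<inter> E)"
    using disj by (rule disjoint_family_on_bisimulation) auto
  then have "(\<lambda>n. \<mu> (A n \<inter> E)) sums \<mu> (\<Union>n. A n \<inter> E)"
    using A E by (intro signed_measure_sums[OF \<mu>s]) auto
  moreover have "A n \<in> sets borel" for n using A by auto
  ultimately show "(\<lambda>n. restrict_meas \<mu> E (A n)) sums restrict_meas \<mu> E (\<Union>n. A n)"
    by (simp add: restrict_meas_def)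
qed (use \<mu> in \<open>auto simp: restrict_meas_def pos_meas_def signed_measure_empty\<close>)

lemma restrict_meas_add_Compl:
  assumes "pos_meas \<mu>" "E \<in> sets borel"
  shows "(\<lambda>A. restrict_meas \<mu> E A + restrict_meas \<mu> (- E) A) = \<mu>"
proof (rule ext)
  fix A
  have \<mu>: "signed_measure \<mu>" using assms(1) by (simp add: pos_meas_def)
  show "restrict_meas \<mu> E A + restrict_meas \<mu> (- E) A = \<mu> A"
    using signed_measure_split[OF \<mu> _ assms(2), of A] signed_measure_notin_borel[OF \<mu>, of A]
    by (simp add: restrict_meas_def Diff_eq)
qed

lemma integral_restrict_meas_cong:
  assumes \<mu>: "pos_meas \<mu>" and E: "E \<in> sets borel"
    and f: "f \<in> borel_measurable borel" and g: "g \<in> borel_measurable borel"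
    and eq: "\<And>x. x \<in> E \<Longrightarrow> f x = (g x :: real)"
  shows "integral\<^sup>L (meas_of_fun (restrict_meas \<mu> E)) f = integral\<^sup>L (meas_of_fun (restrict_meas \<mu> E)) g"
proof (rule integral_cong_AE)
  have "restrict_meas \<mu> E (- E) = 0"
    using \<mu> by (simp add: restrict_meas_def pos_meas_def signed_measure_empty)
  then show "AE x in meas_of_fun (restrict_meas \<mu> E). f x = g x"
    using eq E by (intro AE_I[where N = "- E"])
      (auto simp: emeasure_meas_of_fun pos_meas_restrict_meas \<mu>)
qed (use f g in auto)

text \<open>A positive operator dominating the operator of \<open>q\<close> dominates
  \<open>\<mu> \<mapsto> \<integral> max_upto (\<lambda>j. q x (A \<inter> W j)) n d\<mu>\<close>: split \<open>\<mu>\<close> according to whether the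
  maximum is attained at the last index or before.\<close>

lemma integral_max_upto_kernel_le:
  assumes q: "bounded_kernel q" and V: "bounded_op V"
    and V0: "op_le (\<lambda>\<mu> A. 0) V" and Vq: "op_le (kernel_op q) V"
    and A: "A \<in> sets borel" and W: "\<And>j. W j \<in> sets borel"
    and \<mu>: "pos_meas \<mu>"
  shows "integral\<^sup>L (meas_of_fun \<mu>) (\<lambda>x. max_upto (\<lambda>j. q x (A \<inter> W j)) n) \<le> V \<mu> A"
  using \<mu>
proof (induction n arbitrary: \<mu>)
  case 0
  then show ?case using V0 by (simp add: op_le_def meas_le_def)
next
  case (Suc n)
  obtain C where C: "\<And>x A. \<bar>q x A\<bar> \<le> C" using bounded_kernel_bound[OF q] by blast
  have C0: "0 \<le> C" using C[of undefined undefined] by linarith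
  note \<mu> = Suc.prems
  define g where "g n x = max_upto (\<lambda>j. q x (A \<inter> W j)) n" for n x
  define B where "B = A \<inter> W n"
  \<comment> \<open>On \<open>E\<close> the maximum over the indices below \<open>n\<close> already
    wins; ties go to \<open>E\<close>.\<close>
  define E where "E = {x. q x B \<le> g n x}"
  have B: "B \<in> sets borel" using A W by (simp add: B_def)
  have qm: "(\<lambda>x. q x D) \<in> borel_measurable borel" for D
    by (rule bounded_kernel_measurable[OF q])
  have gm: "g n \<in> borel_measurable borel" for n
    unfolding g_def by (intro borel_measurable_max_upto qm)
  have gC: "\<bar>g n x\<bar> \<le> C" for n x
    using max_upto_le[of "\<lambda>j. q x (A \<inter> W j)" C n] C C0 max_upto_nonneg
    unfolding g_def by (metis abs_le_D1 abs_of_nonneg)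
  have gS: "g (Suc n) x = max (g n x) (q x B)" for x
    by (simp add: g_def B_def)
  have E: "E \<in> sets borel"
    unfolding E_def using qm[of B] gm[of n] by measurable
  let ?\<mu>1 = "restrict_meas \<mu> E" and ?\<mu>2 = "restrict_meas \<mu> (- E)"
  have \<mu>1: "pos_meas ?\<mu>1" and \<mu>2: "pos_meas ?\<mu>2"
    using E by (auto intro!: pos_meas_restrict_meas[OF \<mu>])
  \<comment> \<open>Positivity makes \<open>V ?\<mu>2\<close> monotone, which later allows passing
    from \<open>B\<close> to the larger set \<open>A\<close>.\<close>
  have V2: "pos_meas (V ?\<mu>2)"
    using V0 \<mu>2 bounded_op_signed_measure[OF V] by (auto simp: op_le_def meas_le_def pos_meas_def)
  have "integral\<^sup>L (meas_of_fun \<mu>) (g (Suc n)) =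
      integral\<^sup>L (meas_of_fun ?\<mu>1) (g (Suc n)) + integral\<^sup>L (meas_of_fun ?\<mu>2) (g (Suc n))"
    using integral_meas_of_fun_add[OF \<mu>1 \<mu>2 gm gC] by (simp add: restrict_meas_add_Compl[OF \<mu> E])
  also have "integral\<^sup>L (meas_of_fun ?\<mu>1) (g (Suc n)) = integral\<^sup>L (meas_of_fun ?\<mu>1) (g n)"
    using E gS by (intro integral_restrict_meas_cong[OF \<mu>] gm) (auto simp: E_def)
  also have "integral\<^sup>L (meas_of_fun ?\<mu>2) (g (Suc n)) = integral\<^sup>L (meas_of_fun ?\<mu>2) (\<lambda>x. q x B)"
    using E gS by (intro integral_restrict_meas_cong[OF \<mu>] gm qm) (auto simp: E_def)
  also have "\<dots> = kernel_op q ?\<mu>2 B"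
    by (rule kernel_op_pos_meas[OF q \<mu>2, symmetric])
  also have "\<dots> \<le> V ?\<mu>2 B"
    using Vq \<mu>2 by (simp add: op_le_def meas_le_def)
  also have "\<dots> \<le> V ?\<mu>2 A"
    using A B by (intro pos_meas_mono[OF V2]) (auto simp: B_def)
  \<comment> \<open>The induction hypothesis is applied to the restricted measure, which is why
    \<open>\<mu>\<close> is generalized in the induction.\<close>
  also have "integral\<^sup>L (meas_of_fun ?\<mu>1) (g n) \<le> V ?\<mu>1 A"
    unfolding g_def by (rule Suc.IH[OF \<mu>1])
  also have "V ?\<mu>1 A + V ?\<mu>2 A = V \<mu> A"
    using bounded_op_linear[OF V, of ?\<mu>1 ?\<mu>2 1 1] \<mu>1 \<mu>2 restrict_meas_add_Compl[OF \<mu> E]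
    by (simp add: pos_meas_def)
  finally show ?case by (simp add: g_def)
qed

text \<open>The bound of \<open>integral_max_upto_kernel_le\<close> is uniform in \<open>n\<close>,
  and the maxima converge boundedly to the positive part. Off the Borel sets the left side is 0 and
  positivity of \<open>V\<close> suffices.\<close>

lemma kernel_op_jordan_pos_le:
  fixes q :: "'a::polish_space \<Rightarrow> 'a set \<Rightarrow> real"
  assumes q: "bounded_kernel q" and V: "bounded_op V"
    and V0: "op_le (\<lambda>\<mu> A. 0) V" and Vq: "op_le (kernel_op q) V"
  shows "op_le (kernel_op (\<lambda>x. jordan_pos (q x))) V"
  unfolding op_le_def meas_le_def
proof (intro allI impI)
  fix \<mu> :: "'a set \<Rightarrow> real" and A
  assume \<mu>: "pos_meas \<mu>"
  obtain C where C: "\<And>x A. \<bar>q x A\<bar> \<le> C" using bounded_kernel_bound[OF q] by blast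
  have C0: "0 \<le> C" using C[of undefined undefined] by linarith
  note qp = bounded_kernel_jordan_pos[OF q]
  show "kernel_op (\<lambda>x. jordan_pos (q x)) \<mu> A \<le> V \<mu> A"
  proof (cases "A \<in> sets borel")
    case A: True
    obtain W :: "nat \<Rightarrow> 'a set" where W: "\<And>j. W j \<in> sets borel"
      and lim: "\<And>\<nu> A. signed_measure \<nu> \<Longrightarrow> A \<in> sets borel \<Longrightarrow>
        max_upto (\<lambda>j. \<nu> (A \<inter> W j)) \<longlonglongrightarrow> jordan_pos \<nu> A"
      by (rule jordan_pos_eq_countable_sup) (rule that)
    have "(\<lambda>n. integral\<^sup>L (meas_of_fun \<mu>) (\<lambda>x. max_upto (\<lambda>j. q x (A \<inter> W j)) n))
        \<longlonglongrightarrow> integral\<^sup>L (meas_of_fun \<mu>) (\<lambda>x. jordan_pos (q x) A)"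
    proof (rule integral_meas_of_fun_tendsto[OF \<mu>])
      show "(\<lambda>x. max_upto (\<lambda>j. q x (A \<inter> W j)) n) \<in> borel_measurable borel" for n
        by (intro borel_measurable_max_upto bounded_kernel_measurable[OF q])
      show "\<bar>max_upto (\<lambda>j. q x (A \<inter> W j)) n\<bar> \<le> C" for n x
        using max_upto_le[of "\<lambda>j. q x (A \<inter> W j)" C n] C C0 max_upto_nonneg
        by (metis abs_le_D1 abs_of_nonneg)
      show "(\<lambda>n. max_upto (\<lambda>j. q x (A \<inter> W j)) n) \<longlonglongrightarrow> jordan_pos (q x) A" for x
        by (rule lim[OF bounded_kernel_signed_measure[OF q] A])
    qed
    then show ?thesis
      unfolding kernel_op_pos_meas[OF qp \<mu>]
      by (rule LIMSEQ_le_const2) (intro exI allI impI integral_max_upto_kernel_le[OF q V V0 Vq A W \<mu>])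
  next
    case False
    then have "kernel_op (\<lambda>x. jordan_pos (q x)) \<mu> A = 0"
      using \<mu> signed_measure_notin_borel[OF signed_measure_kernel_op[OF qp]] by (simp add: pos_meas_def)
    then show ?thesis using V0 \<mu> by (simp add: op_le_def meas_le_def)
  qed
qed

subsection \<open>Suprema of kernels\<close>

text \<open>The vector lattice identity that expresses a supremum as \<open>k\<close> plus the
  positive part of \<open>l - k\<close>, used at each \<open>x\<close>.\<close>

definition kernel_sup :: "('a::topological_space \<Rightarrow> 'a set \<Rightarrow> real) \<Rightarrow> ('a \<Rightarrow> 'a set \<Rightarrow> real) \<Rightarrow> 'a \<Rightarrow> 'a set \<Rightarrow> real" where
  "kernel_sup k l x A = k x A + jordan_pos (\<lambda>A. l x A - k x A) A"

lemma bounded_kernel_sup: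
  fixes k l :: "'a::polish_space \<Rightarrow> 'a set \<Rightarrow> real"
  assumes "bounded_kernel k" "bounded_kernel l"
  shows "bounded_kernel (kernel_sup k l)"
  unfolding kernel_sup_def[abs_def]
  by (intro bounded_kernel_add bounded_kernel_jordan_pos bounded_kernel_diff assms)

lemma kernel_sup_upper:
  assumes k: "bounded_kernel k" and l: "bounded_kernel l"
  shows "k x A \<le> kernel_sup k l x A" "l x A \<le> kernel_sup k l x A"
proof -
  have d: "signed_measure (\<lambda>A. l x A - k x A)"
    by (intro signed_measure_diff bounded_kernel_signed_measure k l)
  show "k x A \<le> kernel_sup k l x A"
    using jordan_pos_nonneg[OF d] by (simp add: kernel_sup_def)
  show "l x A \<le> kernel_sup k l x A"
    using jordan_decomposition[OF d, of A] pos_meas_jordan_neg[OF d]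
    unfolding kernel_sup_def pos_meas_def by (smt (verit))
qed

text \<open>Subtracting the operator of \<open>k\<close> from \<open>V\<close> leaves a positive
  operator that dominates the operator of \<open>l - k\<close>. The result on positive parts applies
  to it, and adding the operator of \<open>k\<close> back gives the claim.\<close>

lemma kernel_op_sup_least:
  fixes k l :: "'a::polish_space \<Rightarrow> 'a set \<Rightarrow> real"
  assumes k: "bounded_kernel k" and l: "bounded_kernel l" and V: "bounded_op V"
    and kV: "op_le (kernel_op k) V" and lV: "op_le (kernel_op l) V"
  shows "op_le (kernel_op (kernel_sup k l)) V"
proof -
  define V' where "V' \<mu> A = V \<mu> A - kernel_op k \<mu> A" for \<mu> A
  have V': "bounded_op V'"
    unfolding V'_def[abs_def] by (intro bounded_op_diff V bounded_op_kernel_op k)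
  have "op_le (\<lambda>\<mu> A. 0) V'"
    using kV by (simp add: op_le_def meas_le_def V'_def)
  moreover have "op_le (kernel_op (\<lambda>x A. l x A - k x A)) V'"
    using lV by (simp add: op_le_def meas_le_def V'_def pos_meas_def kernel_op_diff[OF l k])
  ultimately have le: "op_le (kernel_op (\<lambda>x. jordan_pos (\<lambda>A. l x A - k x A))) V'"
    by (rule kernel_op_jordan_pos_le[OF bounded_kernel_diff[OF l k] V'])
  have eq: "(\<lambda>x A. kernel_sup k l x A - k x A) = (\<lambda>x. jordan_pos (\<lambda>A. l x A - k x A))"
    by (simp add: kernel_sup_def fun_eq_iff)
  have "kernel_op (\<lambda>x. jordan_pos (\<lambda>A. l x A - k x A)) \<mu> A = kernel_op (kernel_sup k l) \<mu> A - kernel_op k \<mu> A"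
    if "pos_meas \<mu>" for \<mu> A
    using kernel_op_diff[OF bounded_kernel_sup[OF k l] k, of \<mu> A] that unfolding eq
    by (simp add: pos_meas_def)
  with le show ?thesis
    by (simp add: op_le_def meas_le_def V'_def)
qed

text \<open>Subtracting \<open>h 0\<close> makes the limit nonnegative. Additivity on pairs passes
  to the limit, and the termwise bound of \<open>h n - h 0\<close> by \<open>p\<close> gives
  countable subadditivity, so \<open>pos_measI\<close> applies.\<close>

lemma signed_measure_increasing_limit:
  assumes h: "\<And>n::nat. signed_measure (h n)" and inc: "\<And>A. incseq (\<lambda>n. h n A)"
    and lim: "\<And>A. (\<lambda>n. h n A) \<longlonglongrightarrow> L A"
  shows "signed_measure L"
proof -
  define p where "p A = L A - h 0 A" for A
  have le: "h n A \<le> L A" for n A using incseq_le[OF inc lim] .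
  have d: "signed_measure (\<lambda>A. h n A - h 0 A)" for n by (intro signed_measure_diff h)
  have limp: "(\<lambda>n. h n A - h 0 A) \<longlonglongrightarrow> p A" for A
    unfolding p_def by (intro tendsto_intros lim)
  have "pos_meas p"
  proof (rule pos_measI)
    fix A :: "'a set" assume "A \<notin> sets borel"
    then show "p A = 0"
      using limp[of A] by (simp add: signed_measure_notin_borel[OF h] LIMSEQ_const_iff)
  next
    fix A :: "'a set" show "0 \<le> p A" using le[of 0 A] by (simp add: p_def)
  next
    fix A B :: "'a set" assume "A \<in> sets borel" "B \<in> sets borel" "A \<inter> B = {}"
    then have "(\<lambda>n. h n (A \<union> B) - h 0 (A \<union> B)) = (\<lambda>n. (h n A - h 0 A) + (h n B - h 0 B))"
      by (simp add: signed_measure_Un[OF h] fun_eq_iff)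
    then have "(\<lambda>n. h n (A \<union> B) - h 0 (A \<union> B)) \<longlonglongrightarrow> p A + p B"
      using tendsto_add[OF limp[of A] limp[of B]] by simp
    then show "p A + p B \<le> p (A \<union> B)"
      using LIMSEQ_unique[OF limp[of "A \<union> B"]] by simp
  next
    fix A :: "nat \<Rightarrow> 'a set"
    assume A: "range A \<subseteq> sets borel" "disjoint_family A" and sm: "summable (\<lambda>n. p (A n))"
    have "h n (\<Union>i. A i) - h 0 (\<Union>i. A i) \<le> (\<Sum>i. p (A i))" for n
      using le by (intro sums_le[OF _ signed_measure_sums[OF d A] summable_sums[OF sm]])
        (simp add: p_def)
    then show "p (\<Union>i. A i) \<le> (\<Sum>i. p (A i))"
      using limp[of "\<Union>i. A i"] by (intro LIMSEQ_le_const2) auto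
  qed
  then have "signed_measure (\<lambda>A. p A + h 0 A)"
    by (intro signed_measure_add h) (simp add: pos_meas_def)
  then show ?thesis by (simp add: p_def)
qed

text \<open>Unlike in \<open>max_upto\<close> the index bound is inclusive, and the start is
  \<open>k 0\<close> instead of 0 because the kernels are signed.\<close>

primrec kernel_sup_upto :: "(nat \<Rightarrow> 'a::topological_space \<Rightarrow> 'a set \<Rightarrow> real) \<Rightarrow> nat \<Rightarrow> 'a \<Rightarrow> 'a set \<Rightarrow> real" where
  "kernel_sup_upto k 0 = k 0"
| "kernel_sup_upto k (Suc n) = kernel_sup (kernel_sup_upto k n) (k (Suc n))"

lemma bounded_kernel_sup_upto:
  fixes k :: "nat \<Rightarrow> 'a::polish_space \<Rightarrow> 'a set \<Rightarrow> real"
  assumes "\<And>n. bounded_kernel (k n)"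
  shows "bounded_kernel (kernel_sup_upto k n)"
  by (induction n) (auto intro: bounded_kernel_sup assms)

lemma incseq_kernel_sup_upto:
  fixes k :: "nat \<Rightarrow> 'a::polish_space \<Rightarrow> 'a set \<Rightarrow> real"
  assumes k: "\<And>n. bounded_kernel (k n)"
  shows "incseq (\<lambda>n. kernel_sup_upto k n x A)"
  by (intro incseq_SucI) (simp add: kernel_sup_upper bounded_kernel_sup_upto k)

lemma kernel_sup_upto_upper:
  fixes k :: "nat \<Rightarrow> 'a::polish_space \<Rightarrow> 'a set \<Rightarrow> real"
  assumes k: "\<And>n. bounded_kernel (k n)"
  shows "k n x A \<le> kernel_sup_upto k n x A"
  by (cases n) (simp_all add: kernel_sup_upper bounded_kernel_sup_upto k)

lemma kernel_op_sup_upto_least: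
  fixes k :: "nat \<Rightarrow> 'a::polish_space \<Rightarrow> 'a set \<Rightarrow> real"
  assumes k: "\<And>n. bounded_kernel (k n)" and V: "bounded_op V" "\<And>n. op_le (kernel_op (k n)) V"
  shows "op_le (kernel_op (kernel_sup_upto k n)) V"
  by (induction n) (auto intro: kernel_op_sup_least bounded_kernel_sup_upto k V)

theorem theorem3p6:
  fixes T :: "nat \<Rightarrow> ('a::polish_space set \<Rightarrow> real) \<Rightarrow> ('a set \<Rightarrow> real)"
    and R S :: "('a set \<Rightarrow> real) \<Rightarrow> ('a set \<Rightarrow> real)"
  assumes "\<And>n. weakly_continuous (T n)"
    and "bounded_op R" and "bounded_op S"
    and "\<And>n. op_le R (T n)" and "\<And>n. op_le (T n) S"
  shows "\<exists>U. is_op_sup T U \<and> weakly_continuous U"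
proof -
  have "\<exists>k. bounded_kernel k \<and> (\<forall>\<mu>. signed_measure \<mu> \<longrightarrow> T n \<mu> = kernel_op k \<mu>)" for n
    using weakly_continuous_imp_kernel_op[OF assms(1)[of n]] by blast
  then obtain k where k: "\<And>n. bounded_kernel (k n)"
    and Tk: "\<And>n \<mu>. signed_measure \<mu> \<Longrightarrow> T n \<mu> = kernel_op (k n) \<mu>"
    by metis
  \<comment> \<open>\<open>op_le\<close> tests positive measures only, and on these
    \<open>T n\<close> and \<open>kernel_op (k n)\<close> coincide.\<close>
  have op_le_T: "op_le (T n) V \<longleftrightarrow> op_le (kernel_op (k n)) V" for n V
    by (auto simp: op_le_def pos_meas_def Tk)
  define h where "h = kernel_sup_upto k"
  have hb: "bounded_kernel (h n)" for n
    unfolding h_def by (intro bounded_kernel_sup_upto k)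
  have hinc: "incseq (\<lambda>n. h n x A)" for x A
    unfolding h_def by (intro incseq_kernel_sup_upto k)
  have hV: "op_le (kernel_op (h n)) V" if "bounded_op V" "\<And>n. op_le (T n) V" for V n
    unfolding h_def using that by (intro kernel_op_sup_upto_least k) (simp_all add: op_le_T)
  \<comment> \<open>At Dirac measures the operator inequality becomes a pointwise bound on the
    kernels, although \<open>S\<close> itself may have no kernel.\<close>
  have hS: "h n x A \<le> S (dirac x) A" for n x A
    using hV[OF assms(3,5), of n] pos_meas_dirac[of x] kernel_op_dirac[OF hb, of n x A]
    unfolding op_le_def meas_le_def by metis
  have kh: "k 0 x A \<le> h n x A" for n x A
    using incseqD[OF hinc, of 0 n] by (simp add: h_def)
  obtain C where C: "\<And>x A. \<bar>k 0 x A\<bar> \<le> C" using bounded_kernel_bound[OF k] by blast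
  obtain D where D: "\<And>\<mu> A. signed_measure \<mu> \<Longrightarrow> \<bar>S \<mu> A\<bar> \<le> D * tv_norm \<mu>"
    using bounded_op_bound[OF assms(3)] by blast
  \<comment> \<open>Nothing is known about the sign of \<open>D\<close>, hence
    \<open>\<bar>D\<bar>\<close>; the factor 2 comes from \<open>tv_norm_dirac_le\<close>.\<close>
  have SD: "\<bar>S (dirac x) A\<bar> \<le> \<bar>D\<bar> * 2" for x A
  proof -
    have x: "signed_measure (dirac x)" using pos_meas_dirac[of x] by (simp add: pos_meas_def)
    have "\<bar>S (dirac x) A\<bar> \<le> D * tv_norm (dirac x)" by (rule D[OF x])
    also have "\<dots> \<le> \<bar>D\<bar> * 2"
      using tv_norm_dirac_le[of x] tv_norm_nonneg[OF x] by (intro mult_mono) auto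
    finally show ?thesis .
  qed
  \<comment> \<open>The kernel \<open>k 0\<close> bounds \<open>h n\<close> from below and
    \<open>S\<close> bounds it from above, both uniformly in \<open>n\<close> and
    \<open>x\<close>.\<close>
  have hC: "\<bar>h n x A\<bar> \<le> C + \<bar>D\<bar> * 2" for n x A
    using kh[of x A n] hS[of n x A] C[of x A] SD[of x A] by linarith
  define K where "K x A = lim (\<lambda>n. h n x A)" for x A
  have lim: "(\<lambda>n. h n x A) \<longlonglongrightarrow> K x A" for x A
  proof -
    have "\<forall>i. h i x A \<le> S (dirac x) A" using hS by simp
    then obtain L where "(\<lambda>n. h n x A) \<longlonglongrightarrow> L"
      by (rule incseq_convergent[OF hinc]) (rule that)
    then show ?thesis unfolding K_def by (simp add: limI)
  qed
  have Kb: "bounded_kernel K"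
  proof (rule bounded_kernelI)
    show "signed_measure (K x)" for x
      by (rule signed_measure_increasing_limit[OF bounded_kernel_signed_measure[OF hb] hinc lim])
    show "(\<lambda>x. K x A) \<in> borel_measurable borel" for A
      by (rule borel_measurable_LIMSEQ_real[OF lim bounded_kernel_measurable[OF hb]])
    show "\<bar>K x A\<bar> \<le> C + \<bar>D\<bar> * 2" for x A
      using hC by (intro LIMSEQ_le_const2[OF tendsto_rabs[OF lim]]) auto
  qed
  have "op_le (T n) (kernel_op K)" for n
    unfolding op_le_T
  proof (rule kernel_op_mono[OF k Kb])
    fix x A
    have "k n x A \<le> h n x A" unfolding h_def by (intro kernel_sup_upto_upper k)
    also have "\<dots> \<le> K x A" by (rule incseq_le[OF hinc lim])
    finally show "k n x A \<le> K x A" .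
  qed
  \<comment> \<open>Any upper bound \<open>V\<close> dominates the operators of all finite suprema
    \<open>h n\<close>, and dominated convergence transfers this to their limit.\<close>
  moreover have "op_le (kernel_op K) V" if V: "bounded_op V" "\<And>n. op_le (T n) V" for V
    unfolding op_le_def meas_le_def
  proof (intro allI impI)
    fix \<mu> :: "'a set \<Rightarrow> real" and A :: "'a set"
    assume \<mu>: "pos_meas \<mu>"
    have conv: "(\<lambda>n. kernel_op (h n) \<mu> A) \<longlonglongrightarrow> kernel_op K \<mu> A"
      unfolding kernel_op_pos_meas[OF hb \<mu>] kernel_op_pos_meas[OF Kb \<mu>]
      by (rule integral_meas_of_fun_tendsto[OF \<mu> bounded_kernel_measurable[OF hb] hC lim])
    have "kernel_op (h n) \<mu> A \<le> V \<mu> A" for n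
      using hV[OF V] \<mu> by (simp add: op_le_def meas_le_def)
    then show "kernel_op K \<mu> A \<le> V \<mu> A"
      by (intro LIMSEQ_le_const2[OF conv]) auto
  qed
  ultimately have "is_op_sup T (kernel_op K)"
    unfolding is_op_sup_def using bounded_op_kernel_op[OF Kb] by blast
  then show ?thesis
    using weakly_continuous_kernel_op[OF Kb] by blast
qed

end
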